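(* Let $D(t,\beta)$ be the weighted kneading determinant of $F$ (setting in the context), and assume that the forward orbit of every one-sided endpoint $a_i^{\pm}$ is periodic, eventually periodic, or eventually enters the hole $I_h$. Then: (i) If $\beta$ is the unique solution of $D(1,\beta)=0$, then $\beta$ is the Hausdorff dimension of the attractor $E$. (ii) If $t_1$ is the least real positive solution of $D(t,1)=0$, then $\log(t_1)$ is the escape rate of the pair $(E,F)$. (iii) If $t_0$ is the least real positive solution of $D(t,0)=0$, then $\log(t_0^{-1})$ is the topological entropy of $F$.
   Context: Setting. Let $I\subset\mathbb{R}$ be a compact interval and $f_i(x)=\rho_i x+\varrho_i$ ($i=1,\dots,n$) with $0<|\rho_i|<1$, $\varrho_i\in\mathbb{R}$, an iterated function system satisfying the open set condition, with attractor (self-similar set) $E$. Assume $I$ is the union of a nonempty open interval $I_h$ (the hole) and the intervals $f_1(I),\dots,f_n(I)$, these $n+1$ sets having pairwise disjoint interiors and $I_h$ being disjoint from the $f_i(I)$. Define the piecewise affine expanding map $F$ on $\bigcup_i f_i(I)$ by $F(x)=f_i^{-1}(x)$ for $x\in f_i(I)$; points of the hole are mapped out of $I$. The laps $f_i(I)$ and the hole, ordered along $I$, are consecutive intervals with endpoints $a_1<a_2<\dots<a_{n+2}$, the hole being $(a_h,a_{h+1})$; the interior endpoints $a_2,\dots,a_{n+1}$ are the discontinuity and turning points of $F$. The laps, from left to right, carry symbols $L\prec M_1\prec\dots\prec M_{n-2}\prec R$, and the hole carries the symbol $H$ (inserted in this order at its position). Weighted kneading determinant. For a one-sided limit point $a_i^{\pm}$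 let $S_k$ be the symbol of the interval containing $F^k(a_i^{\pm})$ (iterates computed as one-sided limits). For $\beta\in\mathbb{R}$ put $\tau_0=1$ and $\tau_k=\prod_{l=0}^{k-1}\varepsilon_l\,|F'(F^l(a_i^{\pm}))|^{-\beta}$ for $k>0$, where $\varepsilon_l=1$ if $F$ is increasing at $F^l(a_i^\pm)$, $-1$ if decreasing, and $0$ if $F^l(a_i^\pm)\in I_h$. The weighted invariant coordinate is $\theta_{a_i^{\pm}}(t,\beta)=\lim_{x\to a_i^{\pm}}\sum_{k\ge0}\tau_k t^k S_k$, a formal power series with coefficients in formal combinations of symbols. The weighted kneading increments are $\nu_{a_i}(t,\beta)=\theta_{a_i^+}(t,\beta)-\theta_{a_i^-}(t,\beta)$ for interior endpoints $a_i$ not bounding the hole, and $\nu_{a_h}(t,\beta)=\theta_{a_h^-}(t,\beta)$, $\nu_{a_{h+1}}(t,\beta)=\theta_{a_{h+1}^+}(t,\beta)$. Writing $\nu_{a_i}(t,\beta)=N_{i1}L+N_{i2}M_1+\dots+N_{i(n-1)}M_{n-2}+N_{in}R$ (coefficients of the lap symbols), the $n\times n$ matrix $N(t,\beta)=[N_{ij}(t,\beta)]$ is the weighted kneading matrix and $D(t,\beta)=\det N(t,\beta)$ the weighted kneading determinant. Escape rate: $\gamma=-\lim_{k\to\infty}\frac1k\log \mathrm{Leb}\{x\in I: F^j(x)\text{ is defined and lies outside } I_h \text{ for } 0\le j<k\}$ (equivalently minus the topological pressure of $-\log|F'|$). *)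

theory Defs
  imports "HOL-Analysis.Analysis" "HOL-Computational_Algebra.Formal_Power_Series"
begin

definition aff :: "(nat \<Rightarrow> real) \<Rightarrow> (nat \<Rightarrow> real) \<Rightarrow> nat \<Rightarrow> real \<Rightarrow> real" where
  "aff \<rho> \<rho>' i x = \<rho> i * x + \<rho>' i"

definition open_set_condition :: "nat \<Rightarrow> (nat \<Rightarrow> real \<Rightarrow> real) \<Rightarrow> bool" where
  "open_set_condition n f \<longleftrightarrow>
     (\<exists>V::real set. open V \<and> V \<noteq> {} \<and> (\<forall>i<n. f i ` V \<subseteq> V) \<and>
        (\<forall>i<n. \<forall>j<n. i \<noteq> j \<longrightarrow> f i ` V \<inter> f j ` V = {}))"

definition dpow :: "real \<Rightarrow> real set \<Rightarrow> real" where
  "dpow s U = (if U = {} then 0 else if s = 0 then 1 else diameter U powr s)"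

definition hausdorff_content :: "real \<Rightarrow> real \<Rightarrow> real set \<Rightarrow> ennreal" where
  "hausdorff_content s \<delta> A =
     (INF U \<in> {U :: nat \<Rightarrow> real set. A \<subseteq> (\<Union>i. U i) \<and> (\<forall>i. bounded (U i) \<and> diameter (U i) \<le> \<delta>)}.
        (\<Sum>i. ennreal (dpow s (U i))))"

definition hausdorff_measure :: "real \<Rightarrow> real set \<Rightarrow> ennreal" where
  "hausdorff_measure s A = (SUP \<delta> \<in> {0<..}. hausdorff_content s \<delta> A)"

definition hausdorff_dim :: "real set \<Rightarrow> real" where
  "hausdorff_dim A = Inf {s. 0 \<le> s \<and> hausdorff_measure s A = 0}"

text \<open>F(x) = f_i^{-1}(x) for x in f_i(I), I = {c..d}; None means x is not in any lap
  (i.e. x lies in the hole, or outside I).\<close>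
definition Fopt :: "nat \<Rightarrow> (nat \<Rightarrow> real) \<Rightarrow> (nat \<Rightarrow> real) \<Rightarrow> real \<Rightarrow> real \<Rightarrow> real \<Rightarrow> real option" where
  "Fopt n \<rho> \<rho>' c d x =
     (if \<exists>i<n. x \<in> aff \<rho> \<rho>' i ` {c..d}
      then (let i = (SOME i. i < n \<and> x \<in> aff \<rho> \<rho>' i ` {c..d}) in Some ((x - \<rho>' i) / \<rho> i))
      else None)"

primrec Fiter :: "nat \<Rightarrow> (nat \<Rightarrow> real) \<Rightarrow> (nat \<Rightarrow> real) \<Rightarrow> real \<Rightarrow> real \<Rightarrow> nat \<Rightarrow> real \<Rightarrow> real option" where
  "Fiter n \<rho> \<rho>' c d 0 x = Some x"
| "Fiter n \<rho> \<rho>' c d (Suc k) x = Option.bind (Fiter n \<rho> \<rho>' c d k x) (Fopt n \<rho> \<rho>' c d)"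

definition survivors :: "nat \<Rightarrow> (nat \<Rightarrow> real) \<Rightarrow> (nat \<Rightarrow> real) \<Rightarrow> real \<Rightarrow> real \<Rightarrow> real set \<Rightarrow> nat \<Rightarrow> real set" where
  "survivors n \<rho> \<rho>' c d H k =
     {x \<in> {c..d}. \<forall>j<k. \<exists>y. Fiter n \<rho> \<rho>' c d j x = Some y \<and> y \<notin> H}"

text \<open>Total version of F (the value on points outside the laps is irrelevant on E).\<close>
definition Ftot :: "nat \<Rightarrow> (nat \<Rightarrow> real) \<Rightarrow> (nat \<Rightarrow> real) \<Rightarrow> real \<Rightarrow> real \<Rightarrow> real \<Rightarrow> real" where
  "Ftot n \<rho> \<rho>' c d x = (case Fopt n \<rho> \<rho>' c d x of None \<Rightarrow> x | Some y \<Rightarrow> y)"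

definition separated_set :: "(real \<Rightarrow> real) \<Rightarrow> real set \<Rightarrow> nat \<Rightarrow> real \<Rightarrow> real set \<Rightarrow> bool" where
  "separated_set T X k \<epsilon> S \<longleftrightarrow> S \<subseteq> X \<and> finite S \<and>
     (\<forall>x\<in>S. \<forall>y\<in>S. x \<noteq> y \<longrightarrow> (\<exists>j<k. dist ((T ^^ j) x) ((T ^^ j) y) > \<epsilon>))"

definition max_separated :: "(real \<Rightarrow> real) \<Rightarrow> real set \<Rightarrow> nat \<Rightarrow> real \<Rightarrow> ereal" where
  "max_separated T X k \<epsilon> = Sup {ereal (real (card S)) | S. separated_set T X k \<epsilon> S}"

definition ln_ereal :: "ereal \<Rightarrow> ereal" where
  "ln_ereal x = (if x = \<infinity> then \<infinity> else if x \<le> 0 then -\<infinity> else ereal (ln (real_of_ereal x)))"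

definition topological_entropy :: "(real \<Rightarrow> real) \<Rightarrow> real set \<Rightarrow> ereal" where
  "topological_entropy T X =
     (SUP \<epsilon> \<in> {0<..}. limsup (\<lambda>k. ln_ereal (max_separated T X k \<epsilon>) / ereal (real k)))"

text \<open>Endpoints a 1 < ... < a (n+2); intervals [a j, a (j+1)], j = 1..n+1; the hole is
  the h-th one. A one-sided point is a pair (x, s), s = True meaning x^+, s = False x^-.
  lap_pos gives the index j of the interval containing the one-sided point.\<close>
definition lap_pos :: "nat \<Rightarrow> (nat \<Rightarrow> real) \<Rightarrow> real \<Rightarrow> bool \<Rightarrow> nat" where
  "lap_pos n a x s = (THE j. 1 \<le> j \<and> j \<le> n + 1 \<and>
     (if s then a j \<le> x \<and> x < a (Suc j) else a j < x \<and> x \<le> a (Suc j)))"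

definition lap_map :: "nat \<Rightarrow> (nat \<Rightarrow> real) \<Rightarrow> (nat \<Rightarrow> real) \<Rightarrow> (nat \<Rightarrow> real) \<Rightarrow> nat \<Rightarrow> nat" where
  "lap_map n \<rho> \<rho>' a j = (THE i. i < n \<and> aff \<rho> \<rho>' i ` {a 1..a (n+2)} = {a j..a (Suc j)})"

text \<open>Rank (1 = L, 2 = M_1, ..., n = R) of the lap with interval index j (j \<noteq> h).\<close>
definition lap_rank :: "nat \<Rightarrow> nat \<Rightarrow> nat" where
  "lap_rank h j = (if j < h then j else j - 1)"

definition os_step :: "nat \<Rightarrow> (nat \<Rightarrow> real) \<Rightarrow> (nat \<Rightarrow> real) \<Rightarrow> (nat \<Rightarrow> real) \<Rightarrow> nat \<Rightarrow>
    real \<times> bool \<Rightarrow> (real \<times> bool) option" where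
  "os_step n \<rho> \<rho>' a h p =
     (let j = lap_pos n a (fst p) (snd p) in
      if j = h then None
      else let i = lap_map n \<rho> \<rho>' a j in
        Some ((fst p - \<rho>' i) / \<rho> i, if \<rho> i > 0 then snd p else \<not> snd p))"

primrec os_orbit :: "nat \<Rightarrow> (nat \<Rightarrow> real) \<Rightarrow> (nat \<Rightarrow> real) \<Rightarrow> (nat \<Rightarrow> real) \<Rightarrow> nat \<Rightarrow>
    real \<times> bool \<Rightarrow> nat \<Rightarrow> (real \<times> bool) option" where
  "os_orbit n \<rho> \<rho>' a h p 0 = Some p"
| "os_orbit n \<rho> \<rho>' a h p (Suc k) = Option.bind (os_orbit n \<rho> \<rho>' a h p k) (os_step n \<rho> \<rho>' a h)"

text \<open>epsilon_l * |F'(F^l p)|^(-beta) = sgn(rho_i) * |rho_i| powr beta on lap f_i(I); 0 in the hole.\<close>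
definition os_factor :: "nat \<Rightarrow> (nat \<Rightarrow> real) \<Rightarrow> (nat \<Rightarrow> real) \<Rightarrow> (nat \<Rightarrow> real) \<Rightarrow> nat \<Rightarrow> real \<Rightarrow>
    (real \<times> bool) option \<Rightarrow> real" where
  "os_factor n \<rho> \<rho>' a h \<beta> q =
     (case q of None \<Rightarrow> 0
      | Some p \<Rightarrow> (let j = lap_pos n a (fst p) (snd p) in
          if j = h then 0 else let i = lap_map n \<rho> \<rho>' a j in sgn (\<rho> i) * \<bar>\<rho> i\<bar> powr \<beta>))"

definition os_tau :: "nat \<Rightarrow> (nat \<Rightarrow> real) \<Rightarrow> (nat \<Rightarrow> real) \<Rightarrow> (nat \<Rightarrow> real) \<Rightarrow> nat \<Rightarrow> real \<Rightarrow>
    real \<times> bool \<Rightarrow> nat \<Rightarrow> real" where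
  "os_tau n \<rho> \<rho>' a h \<beta> p k = (\<Prod>l<k. os_factor n \<rho> \<rho>' a h \<beta> (os_orbit n \<rho> \<rho>' a h p l))"

text \<open>Coefficient of t^k and of the lap symbol of rank m in theta_p(t,beta).\<close>
definition theta_coeff :: "nat \<Rightarrow> (nat \<Rightarrow> real) \<Rightarrow> (nat \<Rightarrow> real) \<Rightarrow> (nat \<Rightarrow> real) \<Rightarrow> nat \<Rightarrow> real \<Rightarrow>
    real \<times> bool \<Rightarrow> nat \<Rightarrow> nat \<Rightarrow> real" where
  "theta_coeff n \<rho> \<rho>' a h \<beta> p m k =
     os_tau n \<rho> \<rho>' a h \<beta> p k *
     (case os_orbit n \<rho> \<rho>' a h p k of None \<Rightarrow> 0
      | Some q \<Rightarrow> (let j = lap_pos n a (fst q) (snd q) in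
          if j \<noteq> h \<and> lap_rank h j = m then 1 else 0))"

text \<open>Weighted kneading matrix entry N_{rm}(t,beta), as a formal power series in t;
  row r (0..n-1) corresponds to the interior endpoint a (r+2), column m (0..n-1) to the
  lap symbol of rank m+1 (L, M_1, ..., R).\<close>
definition kneading_entry :: "nat \<Rightarrow> (nat \<Rightarrow> real) \<Rightarrow> (nat \<Rightarrow> real) \<Rightarrow> (nat \<Rightarrow> real) \<Rightarrow> nat \<Rightarrow> real \<Rightarrow>
    nat \<Rightarrow> nat \<Rightarrow> real fps" where
  "kneading_entry n \<rho> \<rho>' a h \<beta> r m = Abs_fps (\<lambda>k.
     (let e = r + 2 in
      if e = h then theta_coeff n \<rho> \<rho>' a h \<beta> (a e, False) (m + 1) k
      else if e = h + 1 then theta_coeff n \<rho> \<rho>' a h \<beta> (a e, True) (m + 1) k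
      else theta_coeff n \<rho> \<rho>' a h \<beta> (a e, True) (m + 1) k
           - theta_coeff n \<rho> \<rho>' a h \<beta> (a e, False) (m + 1) k))"

definition kneading_det :: "nat \<Rightarrow> (nat \<Rightarrow> real) \<Rightarrow> (nat \<Rightarrow> real) \<Rightarrow> (nat \<Rightarrow> real) \<Rightarrow> nat \<Rightarrow> real \<Rightarrow> real fps" where
  "kneading_det n \<rho> \<rho>' a h \<beta> =
     (\<Sum>p | p permutes {0..<n}. of_int (sign p) * (\<Prod>r<n. kneading_entry n \<rho> \<rho>' a h \<beta> r (p r)))"

text \<open>Value of a power series at a real point t > 0, understood as the analytic
  continuation along the segment [0,t] of the sum of the series near 0:
  fps_value_at F t y holds iff this continuation exists and takes the value y at t.\<close>
definition fps_value_at :: "real fps \<Rightarrow> real \<Rightarrow> complex \<Rightarrow> bool" where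
  "fps_value_at F t y \<longleftrightarrow>
     (\<exists>U g r. open U \<and> 0 < r \<and> ball 0 r \<subseteq> U \<and> closed_segment 0 (complex_of_real t) \<subseteq> U \<and>
        g holomorphic_on U \<and>
        (\<forall>z\<in>ball 0 r. (\<lambda>k. complex_of_real (fps_nth F k) * z ^ k) sums g z) \<and>
        g (complex_of_real t) = y)"

end

theory Submission
  imports Defs "HOL-Complex_Analysis.Complex_Analysis" "HOL-Real_Asymp.Real_Asymp"
    "Jordan_Normal_Form.Determinant"
begin

text \<open>
  Every lap is mapped onto the whole interval, so after one step each one-sided endpoint sits at
  \<open>c\<^sup>+\<close> or \<open>d\<^sup>-\<close>.  Hence the two invariant coordinates of a lap differ by \<open>t |\<rho>\<^sub>i|\<^sup>\<beta> V\<close>, where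
  \<open>V\<close> is the difference of the coordinates at \<open>d\<^sup>-\<close> and \<open>c\<^sup>+\<close>, and the kneading increments on the
  two sides of the hole telescope.  Row operations then give \<open>D(t,\<beta>) P(t) = z (1 - t W(\<beta>))\<close>
  with \<open>W(\<beta>) = \<Sum> |\<rho>\<^sub>i|\<^sup>\<beta>\<close>, a polynomial \<open>P\<close> and a nonzero integer \<open>z\<close>.  By the identity
  theorem this persists under analytic continuation, so a zero \<open>t\<close> of \<open>D(\<cdot>,\<beta>)\<close> satisfies
  \<open>t W(\<beta>) = 1\<close>.

  It remains to identify the three quantities: the dimension is the root of \<open>W(\<beta>) = 1\<close> (Moran,
  with the mass distribution principle for the lower bound), the surviving set at time \<open>k\<close> has
  measure \<open>W(1)\<^sup>k (d - c)\<close>, and the entropy on \<open>E\<close> is \<open>ln n = ln W(0)\<close>.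
\<close>

section \<open>Determinants and analytic continuation\<close>

text \<open>The polynomial \<open>P\<close> comes from a 2x2 linear system: each of the coordinates
  at \<open>c+\<close> and \<open>d-\<close> is a symbol plus
  \<open>t |\<rho>\<^sub>i|\<^sup>\<beta>\<close> times plus or minus one of the two, and
  \<open>P\<close> is the determinant of that system. It may vanish at a positive real
  \<open>t\<close>, so it is kept as a factor on the left and never divided by; a zero of
  \<open>D\<close> still forces a zero of the right side. The recurring obstacle in the other half
  is that neighbouring laps share an endpoint. There the branch of \<open>F\<close> is an arbitrary
  choice and cylinders are not disjoint. Hence the survivors are compared with a union of closed
  cylinders up to a finite set, masses are shown to ignore whatever misses the open interval, and
  the points counted for the entropy are kept inside it. The mass distribution principle is run
  without a limit measure: by compactness a cover of \<open>E\<close> may be taken finite, and then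
  the cylinders of one sufficiently high level already detect it.\<close>

definition fdet :: "nat \<Rightarrow> (nat \<Rightarrow> nat \<Rightarrow> 'a::comm_ring_1) \<Rightarrow> 'a" where
  "fdet n f = (\<Sum>p | p permutes {0..<n}. of_int (sign p) * (\<Prod>r<n. f r (p r)))"

lemma fdet_eq_det: "fdet n f = Determinant.det (mat n n (\<lambda>(i, j). f i j))"
proof -
  have "(\<Prod>r<n. f r (p r)) = (\<Prod>i = 0..<n. mat n n (\<lambda>(i, j). f i j) $$ (i, p i))"
    if "p permutes {0..<n}" for p
  proof -
    have "p i < n" if "i < n" for i
      using permutes_in_image[OF \<open>p permutes {0..<n}\<close>, of i] that by auto
    then show ?thesis
      by (auto simp: atLeast0LessThan intro!: prod.cong)
  qed
  then show ?thesis
    unfolding fdet_def Determinant.det_def by (auto intro!: sum.cong)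
qed

lemma fdet_cong:
  assumes "\<And>i j. i < n \<Longrightarrow> j < n \<Longrightarrow> f i j = g i j"
  shows "fdet n f = fdet n g"
proof -
  have "mat n n (\<lambda>(i, j). f i j) = mat n n (\<lambda>(i, j). g i j)"
    using assms by (intro eq_matI) auto
  then show ?thesis by (simp add: fdet_eq_det)
qed

text \<open>This is Cramer's lemma, which speaks of columns, applied to the transposed matrix. The
  combination includes the old row \<open>k\<close>, and only that term survives, with its
  coefficient \<open>x k\<close>.\<close>

lemma fdet_replace_row:
  fixes f :: "nat \<Rightarrow> nat \<Rightarrow> 'a::comm_ring_1"
  assumes k: "k < n" and row: "\<And>j. j < n \<Longrightarrow> g j = (\<Sum>l<n. x l * f l j)"
  shows "fdet n (\<lambda>i. if i = k then g else f i) = x k * fdet n f"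
proof -
  define A where "A = mat n n (\<lambda>(i, j). f j i)"
  have A: "A \<in> carrier_mat n n" by (simp add: A_def)
  have "transpose_mat (mat n n (\<lambda>(i, j). (if i = k then g else f i) j))
      = replace_col A (A *\<^sub>v vec n x) k"
    by (intro eq_matI)
      (auto simp: A_def replace_col_def row scalar_prod_def atLeast0LessThan mult.commute)
  moreover have "transpose_mat (mat n n (\<lambda>(i, j). f i j)) = A"
    by (intro eq_matI) (auto simp: A_def)
  ultimately have
    "fdet n (\<lambda>i. if i = k then g else f i) = Determinant.det (replace_col A (A *\<^sub>v vec n x) k)"
    "fdet n f = Determinant.det A"
    unfolding fdet_eq_det
    by (metis det_transpose mat_carrier)+
  then show ?thesis
    using cramer_lemma_mat[OF A, of "vec n x" k] k by simp
qed

text \<open>Since \<open>S\<close> avoids \<open>u\<close> and \<open>v\<close>, these two rows keep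
  their original values, and the rows of \<open>S\<close> can be changed one at a time.\<close>

lemma fdet_add_two_rows:
  fixes f :: "nat \<Rightarrow> nat \<Rightarrow> 'a::comm_ring_1"
  assumes uv: "u < n" "v < n" and "finite S" "S \<subseteq> {..<n} - {u, v}"
  shows "fdet n (\<lambda>i j. if i \<in> S then f i j + x i * f u j + y i * f v j else f i j) = fdet n f"
  using assms(3,4)
proof (induction S rule: finite_induct)
  case (insert k S)
  define g where "g = (\<lambda>i j. if i \<in> S then f i j + x i * f u j + y i * f v j else f i j)"
  have k: "k < n" "k \<noteq> u" "k \<noteq> v" "u \<notin> S" "v \<notin> S" using insert by auto
  \<comment> \<open>The indicators are added rather than nested, so that the vector is also correct
    when \<open>u = v\<close>.\<close>
  define z where "z = (\<lambda>l. (if l = k then 1 else 0) + (if l = u then x k else 0)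
    + (if l = v then y k else 0))"
  have "fdet n (\<lambda>i. if i = k then \<lambda>j. f k j + x k * f u j + y k * f v j else g i)
      = z k * fdet n g"
  proof (rule fdet_replace_row)
    fix j
    have "(\<Sum>l<n. z l * g l j) = (\<Sum>l<n. (if l = k then g l j else 0)
        + (if l = u then x k * g l j else 0) + (if l = v then y k * g l j else 0))"
      by (rule sum.cong) (auto simp: z_def algebra_simps)
    also have "\<dots> = f k j + x k * f u j + y k * f v j"
      using k uv insert.hyps by (simp add: sum.distrib g_def)
    finally show "f k j + x k * f u j + y k * f v j = (\<Sum>l<n. z l * g l j)" ..
  qed (use k in auto)
  moreover have "(\<lambda>i. if i = k then \<lambda>j. f k j + x k * f u j + y k * f v j else g i)
     = (\<lambda>i j. if i \<in> insert k S then f i j + x i * f u j + y i * f v j else f i j)"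
    by (auto simp: g_def fun_eq_iff)
  ultimately show ?case
    using insert k by (auto simp: g_def z_def)
qed simp

text \<open>Changing row \<open>u\<close> first destroys \<open>f u\<close>. Scaling the new row
  \<open>v\<close> by \<open>m11\<close> repairs this: \<open>m11 * (m21 * f u + m22 * f v)\<close>
  is \<open>m21\<close> times the new row \<open>u\<close> plus
  \<open>(m11 * m22 - m12 * m21) * f v\<close>. The factor \<open>m11\<close> is cancelled at the
  end, which is why an integral domain is assumed.\<close>

lemma fdet_two_row_comb:
  fixes f :: "nat \<Rightarrow> nat \<Rightarrow> 'a::idom"
  assumes uv: "u < n" "v < n" "u \<noteq> v" and "m11 \<noteq> 0"
  shows "fdet n (\<lambda>i j. if i = u then m11 * f u j + m12 * f v j
      else if i = v then m21 * f u j + m22 * f v j else f i j)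
    = (m11 * m22 - m12 * m21) * fdet n f" (is "fdet n ?F = _")
proof -
  define g where "g = (\<lambda>i. if i = u then \<lambda>j. m11 * f u j + m12 * f v j else f i)"
  have two: "(\<Sum>l<n. (if l = u then r else if l = v then s else 0) * w l) = r * w u + s * w v"
    for r s and w :: "nat \<Rightarrow> 'a"
  proof -
    have "(\<Sum>l<n. (if l = u then r else if l = v then s else 0) * w l)
      = (\<Sum>l<n. (if l = u then r * w l else 0) + (if l = v then s * w l else 0))"
      by (rule sum.cong) (use uv in auto)
    then show ?thesis using uv by (simp add: sum.distrib)
  qed
  have g: "fdet n g = m11 * fdet n f"
    unfolding g_def
    by (subst fdet_replace_row[where x = "\<lambda>l. if l = u then m11 else if l = v then m12 else 0"])
      (use uv in \<open>simp_all add: two\<close>)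
  have "m11 * fdet n ?F = fdet n (\<lambda>i. if i = v then \<lambda>j. m11 * ?F v j else ?F i)"
    by (subst fdet_replace_row[where x = "\<lambda>l. if l = u then 0 else if l = v then m11 else 0"])
      (use uv in \<open>simp_all add: two\<close>)
  also have "\<dots> = fdet n (\<lambda>i. if i = v then \<lambda>j. m11 * (m21 * f u j + m22 * f v j) else g i)"
    by (rule fdet_cong) (use uv in \<open>auto simp: g_def\<close>)
  also have "\<dots> = (m11 * m22 - m12 * m21) * fdet n g"
    by (subst fdet_replace_row[where x = "\<lambda>l. if l = u then m21 else
        if l = v then m11 * m22 - m12 * m21 else 0"])
      (use uv in \<open>simp_all add: two g_def algebra_simps\<close>)
  finally show ?thesis using g \<open>m11 \<noteq> 0\<close> by simp
qed

text \<open>Near 0 the identity of power series is an identity of functions,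
  \<open>g * P = Q\<close>. Both sides are holomorphic where \<open>g\<close> is, so the identity
  theorem carries it to \<open>t\<close>. The product form stays meaningful where \<open>P\<close>
  vanishes.\<close>

lemma fps_value_at_mult_poly:
  fixes F :: "real fps"
  assumes val: "fps_value_at F t y" and eq: "F * fps_of_poly P = fps_of_poly Q"
  shows "y * complex_of_real (poly P t) = complex_of_real (poly Q t)"
proof -
  obtain U g r where U: "open U" "0 < r" "ball 0 r \<subseteq> U"
      "closed_segment 0 (complex_of_real t) \<subseteq> U" "g holomorphic_on U"
    and g: "\<And>z. z \<in> ball 0 r \<Longrightarrow> (\<lambda>k. complex_of_real (fps_nth F k) * z ^ k) sums g z"
    and y: "g (complex_of_real t) = y"
    using val unfolding fps_value_at_def by blast
  define G where "G = Abs_fps (\<lambda>k. complex_of_real (fps_nth F k))"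
  define cP where "cP = map_poly complex_of_real P"
  define cQ where "cQ = map_poly complex_of_real Q"
  have GP: "G * fps_of_poly cP = fps_of_poly cQ"
  proof (rule fps_ext)
    fix k
    have "fps_nth (F * fps_of_poly P) k = fps_nth (fps_of_poly Q) k" using eq by simp
    then have "complex_of_real (fps_nth (F * fps_of_poly P) k) = complex_of_real (coeff Q k)" by simp
    then show "fps_nth (G * fps_of_poly cP) k = fps_nth (fps_of_poly cQ) k"
      by (simp add: fps_mult_nth G_def cP_def cQ_def coeff_map_poly)
  qed
  have radius: "ereal r \<le> fps_conv_radius G"
    unfolding fps_conv_radius_def
  proof (rule conv_radius_geI_ex)
    fix s :: real assume "0 < s" "ereal s < ereal r"
    then have "complex_of_real s \<in> ball 0 r" by simp
    from sums_summable[OF g[OF this]] \<open>0 < s\<close>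
    show "\<exists>z. norm z = s \<and> summable (\<lambda>n. fps_nth G n * z ^ n)"
      by (intro exI[of _ "complex_of_real s"]) (auto simp: G_def)
  qed
  \<comment> \<open>The domain \<open>U\<close> of the continuation is only open; the identity
    theorem needs a connected set, here the component that contains the segment.\<close>
  define S where "S = connected_component_set U 0"
  have S: "open S" "connected S" "S \<subseteq> U" "0 \<in> S"
    using U by (auto simp: S_def open_connected_component connected_component_subset
        connected_component_refl_eq)
  have ball: "ball 0 r \<subseteq> S"
    unfolding S_def using U by (intro connected_component_maximal) auto
  have tS: "complex_of_real t \<in> S"
    using connected_component_maximal[of 0 "closed_segment 0 (complex_of_real t)" U] U
    by (auto simp: S_def)
  have "g (complex_of_real t) * poly cP (complex_of_real t) = poly cQ (complex_of_real t)"
  proof (rule analytic_continuation_open[where f = "\<lambda>z. g z * poly cP z" and g = "poly cQ"])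
    show "ball 0 r \<subseteq> S" by (rule ball)
    show "(\<lambda>z. g z * poly cP z) holomorphic_on S"
      using U S by (auto intro!: holomorphic_intros holomorphic_on_subset[of g U])
    show "g z * poly cP z = poly cQ z" if "z \<in> ball 0 r" for z
    proof -
      have z: "ereal (norm z) < fps_conv_radius G"
        using radius that by (auto intro: less_le_trans[of _ "ereal r"])
      have "g z = eval_fps G z"
        using g[OF that] sums_eval_fps[OF z] by (simp add: G_def sums_unique2)
      moreover have "eval_fps (G * fps_of_poly cP) z = eval_fps G z * eval_fps (fps_of_poly cP) z"
        by (rule eval_fps_mult) (use z in auto)
      ultimately show ?thesis using GP by simp
    qed
  qed (use U S tS in \<open>auto intro!: holomorphic_intros\<close>)
  moreover have "poly (map_poly complex_of_real R) (complex_of_real t) = complex_of_real (poly R t)"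
    for R
    by (induction R) (simp_all add: map_poly_pCons)
  ultimately show ?thesis using y by (simp add: cP_def cQ_def)
qed

text \<open>A cylinder weight \<open>r powr \<beta>\<close> exactly compensates the stretching of
  lengths by \<open>1 / r\<close>; hence a bound \<open>K * z powr \<beta>\<close> passes through a
  lap with the same constant.\<close>

lemma powr_scale: "0 < r \<Longrightarrow> 0 \<le> z \<Longrightarrow> r powr \<beta> * (K * (z / r) powr \<beta>) = K * z powr \<beta>"
  for r z :: real
  by (simp add: powr_divide)

lemma dpow_nonneg: "0 \<le> dpow s U"
  by (simp add: dpow_def)

section \<open>The kneading determinant\<close>

locale holed_ifs =
  fixes n :: nat and \<rho> \<rho>' :: "nat \<Rightarrow> real" and c d p q :: real
    and a :: "nat \<Rightarrow> real" and h :: nat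
  assumes n_ge: "2 \<le> n"
    and I_nontriv: "c < d"
    and contr: "\<forall>i<n. 0 < \<bar>\<rho> i\<bar> \<and> \<bar>\<rho> i\<bar> < 1"
    and cover: "{c..d} = {p<..<q} \<union> (\<Union>i<n. aff \<rho> \<rho>' i ` {c..d})"
    and disj_laps: "\<forall>i<n. \<forall>j<n. i \<noteq> j \<longrightarrow>
                      interior (aff \<rho> \<rho>' i ` {c..d}) \<inter> interior (aff \<rho> \<rho>' j ` {c..d}) = {}"
    and disj_hole: "\<forall>i<n. {p<..<q} \<inter> aff \<rho> \<rho>' i ` {c..d} = {}"
    and a_mono: "\<forall>j\<in>{1..n+1}. a j < a (Suc j)"
    and a_ends: "a 1 = c" "a (n + 2) = d"
    and h_range: "1 \<le> h" "h \<le> n + 1"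
    and hole_ends: "a h = p" "a (Suc h) = q"
    and laps_layout: "\<forall>j\<in>{1..n+1}. j \<noteq> h \<longrightarrow> (\<exists>i<n. aff \<rho> \<rho>' i ` {c..d} = {a j..a (Suc j)})"
begin

abbreviation f :: "nat \<Rightarrow> real \<Rightarrow> real" where "f i \<equiv> aff \<rho> \<rho>' i"
text \<open>Two indexings coexist: positions from left to right, and the numbering of the maps,
  which need not follow that order. This translates a position into the number of its map.\<close>

abbreviation lap :: "nat \<Rightarrow> nat" where "lap j \<equiv> lap_map n \<rho> \<rho>' a j"
abbreviation laps :: "nat set" where "laps \<equiv> {1..n+1} - {h}"

section \<open>Geometry of the laps\<close>

lemma rho_nz: "i < n \<Longrightarrow> \<rho> i \<noteq> 0"
  using contr by fastforce

lemma a_less: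
  assumes "1 \<le> i" "i < j" "j \<le> n + 2"
  shows "a i < a j"
  using assms(2,3)
proof (induction j)
  case (Suc j)
  then have "a j < a (Suc j)" using a_mono assms(1) by auto
  then show ?case using Suc by (cases "i = j") auto
qed simp

lemma a_le: "1 \<le> i \<Longrightarrow> i \<le> j \<Longrightarrow> j \<le> n + 2 \<Longrightarrow> a i \<le> a j"
  using a_less[of i j] by (cases "i = j") auto

text \<open>The definite description is legitimate because two different maps with the same image
  would have images with intersecting interiors.\<close>

lemma lap_image:
  assumes "j \<in> laps"
  shows "lap j < n" "f (lap j) ` {c..d} = {a j..a (Suc j)}"
proof -
  have ends: "a (Suc 0) = c" "a (Suc (Suc n)) = d" using a_ends by simp_all
  obtain i where i: "i < n" "f i ` {c..d} = {a j..a (Suc j)}"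
    using laps_layout assms by auto
  have "a j < a (Suc j)" using a_mono assms by auto
  then have ne: "interior {a j..a (Suc j)} \<noteq> {}" by simp
  have "lap j = i"
    unfolding lap_map_def
  proof (rule the_equality)
    fix i' assume "i' < n \<and> f i' ` {a 1..a (n+2)} = {a j..a (Suc j)}"
    then show "i' = i" using i ne disj_laps ends by (metis Int_absorb One_nat_def add_2_eq_Suc')
  qed (use i ends in auto)
  then show "lap j < n" "f (lap j) ` {c..d} = {a j..a (Suc j)}" using i by auto
qed

text \<open>Equal images have equal left endpoints, which gives injectivity; surjectivity is
  counting, since \<open>n + 1\<close> positions without the hole leave \<open>n\<close>.\<close>

lemma bij_lap: "bij_betw lap laps {..<n}"
proof -
  have inj: "inj_on lap laps"
  proof (rule inj_onI)
    fix j k assume jk: "j \<in> laps" "k \<in> laps" "lap j = lap k"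
    then have eq: "{a j..a (Suc j)} = {a k..a (Suc k)}" using lap_image by metis
    moreover have "a j < a (Suc j)" using a_mono jk by auto
    ultimately have "a j = a k" by (simp add: Icc_eq_Icc)
    then show "j = k"
      using a_less[of j k] a_less[of k j] jk by (cases j k rule: linorder_cases) auto
  qed
  have sub: "lap ` laps \<subseteq> {..<n}" using lap_image(1) by blast
  have "card laps = n" using h_range by simp
  then have "lap ` laps = {..<n}"
    using card_image[OF inj] by (intro card_subset_eq sub) simp_all
  with inj show ?thesis by (simp add: bij_betw_def)
qed

lemma lap_cases:
  assumes "i < n"
  obtains j where "j \<in> laps" "i = lap j" "f i ` {c..d} = {a j..a (Suc j)}"
  using bij_lap assms lap_image(2) unfolding bij_betw_def by (metis imageE lessThan_iff)

text \<open>The open hole does not contain \<open>c\<close> or \<open>d\<close>, so each of them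
  lies in a lap; were the hole the first or last interval, no lap could reach that end. It follows
  that the hole has a lap on each side and that the rows \<open>h - 2\<close> and
  \<open>h - 1\<close> exist.\<close>

lemma hole_inside: "1 < h" "h \<le> n"
proof -
  have "c \<in> {c..d}" "d \<in> {c..d}" using I_nontriv by auto
  then have cd: "c \<in> {p<..<q} \<or> (\<exists>i<n. c \<in> f i ` {c..d})"
      "d \<in> {p<..<q} \<or> (\<exists>i<n. d \<in> f i ` {c..d})"
    using cover by blast+
  show "1 < h"
  proof (rule ccontr)
    assume "\<not> 1 < h"
    then have "h = 1" using h_range by simp
    then obtain i where "i < n" "c \<in> f i ` {c..d}" using cd hole_ends a_ends by auto
    then obtain j where "j \<in> laps" "a j \<le> c" using lap_cases[of i] by (metis atLeastAtMost_iff)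
    then show False using a_less[of 1 j] \<open>h = 1\<close> a_ends by auto
  qed
  show "h \<le> n"
  proof (rule ccontr)
    assume "\<not> h \<le> n"
    then have "h = n + 1" using h_range by simp
    then obtain i where "i < n" "d \<in> f i ` {c..d}" using cd hole_ends a_ends by auto
    then obtain j where "j \<in> laps" "d \<le> a (Suc j)" using lap_cases[of i] by (metis atLeastAtMost_iff)
    then show False using a_less[of "Suc j" "n + 2"] \<open>h = n + 1\<close> a_ends by auto
  qed
qed

lemma lap_ends:
  assumes "j \<in> laps"
  shows "0 < \<rho> (lap j) \<Longrightarrow> f (lap j) c = a j" "0 < \<rho> (lap j) \<Longrightarrow> f (lap j) d = a (Suc j)"
    "\<rho> (lap j) < 0 \<Longrightarrow> f (lap j) d = a j" "\<rho> (lap j) < 0 \<Longrightarrow> f (lap j) c = a (Suc j)"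
proof -
  have "f (lap j) ` {c..d} = {a j..a (Suc j)}" "a j < a (Suc j)"
    using lap_image a_mono assms by auto
  moreover have "f (lap j) ` {c..d} = (if 0 \<le> \<rho> (lap j) then {f (lap j) c..f (lap j) d}
      else {f (lap j) d..f (lap j) c})"
    using I_nontriv image_affinity_atLeastAtMost[of "\<rho> (lap j)" "\<rho>' (lap j)" c d]
    unfolding aff_def by auto
  ultimately show "0 < \<rho> (lap j) \<Longrightarrow> f (lap j) c = a j" "0 < \<rho> (lap j) \<Longrightarrow> f (lap j) d = a (Suc j)"
    "\<rho> (lap j) < 0 \<Longrightarrow> f (lap j) d = a j" "\<rho> (lap j) < 0 \<Longrightarrow> f (lap j) c = a (Suc j)"
    by (auto simp: Icc_eq_Icc)
qed

section \<open>Invariant coordinates at the one-sided endpoints\<close>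

lemma lap_pos_right:
  assumes "1 \<le> j" "j \<le> n + 1"
  shows "lap_pos n a (a j) True = j"
  unfolding lap_pos_def
proof (rule the_equality)
  fix k assume k: "1 \<le> k \<and> k \<le> n + 1 \<and>
    (if True then a k \<le> a j \<and> a j < a (Suc k) else a k < a j \<and> a j \<le> a (Suc k))"
  then have "\<not> j < k" "\<not> Suc k \<le> j"
    using a_less[of j k] a_le[of "Suc k" j] assms by auto
  then show "k = j" by simp
qed (use assms a_mono in auto)

lemma lap_pos_left:
  assumes "1 \<le> j" "j \<le> n + 1"
  shows "lap_pos n a (a (Suc j)) False = j"
  unfolding lap_pos_def
proof (rule the_equality)
  fix k assume k: "1 \<le> k \<and> k \<le> n + 1 \<and>
    (if False then a k \<le> a (Suc j) \<and> a (Suc j) < a (Suc k)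
     else a k < a (Suc j) \<and> a (Suc j) \<le> a (Suc k))"
  then have "\<not> Suc j \<le> k" "\<not> Suc k < Suc j"
    using a_le[of "Suc j" k] a_less[of "Suc k" "Suc j"] assms by auto
  then show "k = j" by simp
qed (use assms a_mono in auto)

lemma os_orbit_Suc_shift:
  "os_orbit n \<rho> \<rho>' a h x (Suc k)
    = Option.bind (os_step n \<rho> \<rho>' a h x) (\<lambda>y. os_orbit n \<rho> \<rho>' a h y k)"
  by (induction k) (auto split: Option.bind_splits)

lemma theta_coeff_Suc:
  assumes "os_step n \<rho> \<rho>' a h x = Some y"
  shows "theta_coeff n \<rho> \<rho>' a h \<beta> x m (Suc k)
    = os_factor n \<rho> \<rho>' a h \<beta> (Some x) * theta_coeff n \<rho> \<rho>' a h \<beta> y m k"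
proof -
  have orb: "os_orbit n \<rho> \<rho>' a h x (Suc l) = os_orbit n \<rho> \<rho>' a h y l" for l
    using assms by (subst os_orbit_Suc_shift) simp
  have "os_tau n \<rho> \<rho>' a h \<beta> x (Suc k)
    = os_factor n \<rho> \<rho>' a h \<beta> (Some x) * os_tau n \<rho> \<rho>' a h \<beta> y k"
    unfolding os_tau_def by (subst prod.lessThan_Suc_shift) (simp only: orb os_orbit.simps(1))
  then show ?thesis
    unfolding theta_coeff_def by (simp only: orb mult.assoc)
qed

definition theta :: "real \<Rightarrow> real \<Rightarrow> bool \<Rightarrow> nat \<Rightarrow> real fps" where
  "theta \<beta> x s m = Abs_fps (theta_coeff n \<rho> \<rho>' a h \<beta> (x, s) (m + 1))"

text \<open>The factor \<open>t |\<rho>|\<^sup>\<beta>\<close> picked up in one passage through lap \<open>j\<close>, without its sign.\<close>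
definition tw :: "real \<Rightarrow> nat \<Rightarrow> real fps" where
  "tw \<beta> j = fps_const (\<bar>\<rho> (lap j)\<bar> powr \<beta>) * fps_X"

text \<open>Integer entries let the final constant determinant be treated over \<open>int\<close>
  and transported by \<open>of_int\<close>. Columns start at 0 and ranks at 1, hence the
  shift.\<close>

definition symb :: "nat \<Rightarrow> nat \<Rightarrow> int" where
  "symb j m = (if lap_rank h j = m + 1 then 1 else 0)"

lemma theta_step:
  assumes "lap_pos n a x s = j" "j \<in> laps"
  shows "theta \<beta> x s m = of_int (symb j m) + fps_const (sgn (\<rho> (lap j))) * tw \<beta> j *
    theta \<beta> ((x - \<rho>' (lap j)) / \<rho> (lap j)) (if \<rho> (lap j) > 0 then s else \<not> s) m"
proof (rule fps_ext)
  fix k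
  have step: "os_step n \<rho> \<rho>' a h (x, s)
      = Some ((x - \<rho>' (lap j)) / \<rho> (lap j), if \<rho> (lap j) > 0 then s else \<not> s)"
    using assms by (simp add: os_step_def Let_def)
  have fac: "os_factor n \<rho> \<rho>' a h \<beta> (Some (x, s)) = sgn (\<rho> (lap j)) * \<bar>\<rho> (lap j)\<bar> powr \<beta>"
    using assms by (simp add: os_factor_def Let_def)
  have zero: "theta_coeff n \<rho> \<rho>' a h \<beta> (x, s) (m + 1) 0 = of_int (symb j m)"
    using assms by (simp add: theta_coeff_def os_tau_def symb_def Let_def)
  have int: "(of_int i :: real fps) = fps_const (of_int i)" for i
    by (simp add: fps_of_int)
  show "fps_nth (theta \<beta> x s m) k = fps_nth (of_int (symb j m) + fps_const (sgn (\<rho> (lap j))) * tw \<beta> j *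
    theta \<beta> ((x - \<rho>' (lap j)) / \<rho> (lap j)) (if \<rho> (lap j) > 0 then s else \<not> s) m) k"
  proof (cases k)
    case 0
    then show ?thesis using zero by (simp add: theta_def tw_def int)
  next
    case (Suc k')
    then show ?thesis
      using theta_coeff_Suc[OF step, of \<beta> "m + 1" k'] fac
      by (simp add: theta_def tw_def int mult.assoc)
  qed
qed

abbreviation theta_c where "theta_c \<beta> m \<equiv> theta \<beta> c True m"
abbreviation theta_d where "theta_d \<beta> m \<equiv> theta \<beta> d False m"

lemma theta_right:
  assumes "j \<in> laps"
  shows "theta \<beta> (a j) True m = of_int (symb j m)
    + (if 0 < \<rho> (lap j) then tw \<beta> j * theta_c \<beta> m else - tw \<beta> j * theta_d \<beta> m)"
proof -
  have pos: "lap_pos n a (a j) True = j" using assms lap_pos_right by auto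
  have nz: "\<rho> (lap j) \<noteq> 0" using lap_image(1)[OF assms] rho_nz by auto
  show ?thesis
  proof (cases "0 < \<rho> (lap j)")
    case True
    then have "(a j - \<rho>' (lap j)) / \<rho> (lap j) = c"
      using lap_ends(1)[OF assms True] nz by (simp add: aff_def field_simps)
    then show ?thesis using True by (subst theta_step[OF pos assms]) simp
  next
    case False
    then have neg: "\<rho> (lap j) < 0" using nz by simp
    then have "(a j - \<rho>' (lap j)) / \<rho> (lap j) = d"
      using lap_ends(3)[OF assms neg] nz by (simp add: aff_def field_simps)
    then show ?thesis using neg
      by (subst theta_step[OF pos assms]) (simp flip: fps_const_neg)
  qed
qed

lemma theta_left:
  assumes "j \<in> laps"
  shows "theta \<beta> (a (Suc j)) False m = of_int (symb j m)
    + (if 0 < \<rho> (lap j) then tw \<beta> j * theta_d \<beta> m else - tw \<beta> j * theta_c \<beta> m)"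
proof -
  have pos: "lap_pos n a (a (Suc j)) False = j" using assms lap_pos_left by auto
  have nz: "\<rho> (lap j) \<noteq> 0" using lap_image(1)[OF assms] rho_nz by auto
  show ?thesis
  proof (cases "0 < \<rho> (lap j)")
    case True
    then have "(a (Suc j) - \<rho>' (lap j)) / \<rho> (lap j) = d"
      using lap_ends(2)[OF assms True] nz by (simp add: aff_def field_simps)
    then show ?thesis using True by (subst theta_step[OF pos assms]) simp
  next
    case False
    then have neg: "\<rho> (lap j) < 0" using nz by simp
    then have "(a (Suc j) - \<rho>' (lap j)) / \<rho> (lap j) = c"
      using lap_ends(4)[OF assms neg] nz by (simp add: aff_def field_simps)
    then show ?thesis using neg
      by (subst theta_step[OF pos assms]) (simp flip: fps_const_neg)
  qed
qed

text \<open>On a decreasing lap the sign of the slope and the exchange of the two ends cancel, so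
  the orientation disappears from the difference.\<close>

lemma theta_lap_diff:
  assumes "j \<in> laps"
  shows "theta \<beta> (a (Suc j)) False m = theta \<beta> (a j) True m + tw \<beta> j * (theta_d \<beta> m - theta_c \<beta> m)"
  by (simp add: theta_right[OF assms] theta_left[OF assms] algebra_simps)

section \<open>Telescoping sums of kneading increments\<close>

abbreviation N :: "real \<Rightarrow> nat \<Rightarrow> nat \<Rightarrow> real fps" where
  "N \<beta> \<equiv> kneading_entry n \<rho> \<rho>' a h \<beta>"

text \<open>Row \<open>r\<close> belongs to the endpoint \<open>a (r + 2)\<close>, so rows \<open>h - 2\<close> and \<open>h - 1\<close> are those of the two
  ends of the hole.\<close>
lemma kneading_entry_simps:
  "N \<beta> (h - 2) m = theta \<beta> (a h) False m"
  "N \<beta> (h - 1) m = theta \<beta> (a (Suc h)) True m"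
  "r + 2 \<noteq> h \<Longrightarrow> r + 1 \<noteq> h \<Longrightarrow>
     N \<beta> r m = theta \<beta> (a (r + 2)) True m - theta \<beta> (a (r + 2)) False m"
proof -
  have h: "h - 2 + 2 = h" "h - 1 + 2 = Suc h" using hole_inside by auto
  show "N \<beta> (h - 2) m = theta \<beta> (a h) False m"
    "N \<beta> (h - 1) m = theta \<beta> (a (Suc h)) True m"
    unfolding kneading_entry_def theta_def Let_def h by (auto simp: fps_eq_iff)
  show "N \<beta> r m = theta \<beta> (a (r + 2)) True m - theta \<beta> (a (r + 2)) False m"
    if "r + 2 \<noteq> h" "r + 1 \<noteq> h"
    using that unfolding kneading_entry_def theta_def Let_def by (auto simp: fps_eq_iff)
qed

text \<open>On a walk from \<open>c+\<close> to the right, crossing a lap adds its \<open>tw\<close>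
  times the common difference, and passing an endpoint from left to right adds the corresponding
  row. At \<open>k = h - 2\<close> the walk arrives at the left end of the hole.\<close>

lemma left_rows_sum:
  assumes "k < h - 1"
  shows "theta \<beta> (a (k + 2)) False m = theta_c \<beta> m + (\<Sum>r<k. N \<beta> r m)
    + (\<Sum>j=1..k+1. tw \<beta> j) * (theta_d \<beta> m - theta_c \<beta> m)"
  using assms
proof (induction k)
  case 0
  then show ?case using theta_lap_diff[of 1 \<beta> m] a_ends hole_inside
    by (simp add: numeral_2_eq_2)
next
  case (Suc k)
  have lapk: "k + 2 \<in> laps" using Suc hole_inside by auto
  have step: "theta \<beta> (a (Suc k + 2)) False m
      = theta \<beta> (a (k + 2)) True m + tw \<beta> (k + 2) * (theta_d \<beta> m - theta_c \<beta> m)"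
    using theta_lap_diff[of "k + 2" \<beta> m] lapk by simp
  have row: "theta \<beta> (a (k + 2)) True m = theta \<beta> (a (k + 2)) False m + N \<beta> k m"
    using Suc by (subst kneading_entry_simps(3)) auto
  have IH: "theta \<beta> (a (k + 2)) False m = theta_c \<beta> m + (\<Sum>r<k. N \<beta> r m)
    + (\<Sum>j=1..k+1. tw \<beta> j) * (theta_d \<beta> m - theta_c \<beta> m)"
    using Suc by simp
  show ?case
    unfolding step row IH by (simp add: algebra_simps)
qed

text \<open>The same walk, started at the right end of the hole; at \<open>k = n - h\<close> it
  arrives at \<open>d-\<close>.\<close>

lemma right_rows_sum:
  assumes "h + 1 + k \<le> n + 1"
  shows "theta \<beta> (a (h + 2 + k)) False m = theta \<beta> (a (h + 1)) True m + (\<Sum>r=h..<h+k. N \<beta> r m)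
    + (\<Sum>j=h+1..h+1+k. tw \<beta> j) * (theta_d \<beta> m - theta_c \<beta> m)"
  using assms
proof (induction k)
  case 0
  then show ?case using theta_lap_diff[of "h + 1" \<beta> m] by simp
next
  case (Suc k)
  have lapk: "h + 2 + k \<in> laps" using Suc by auto
  have step: "theta \<beta> (a (h + 2 + Suc k)) False m
      = theta \<beta> (a (h + 2 + k)) True m + tw \<beta> (h + 2 + k) * (theta_d \<beta> m - theta_c \<beta> m)"
    using theta_lap_diff[of "h + 2 + k" \<beta> m] lapk by simp
  have row: "theta \<beta> (a (h + 2 + k)) True m = theta \<beta> (a (h + 2 + k)) False m + N \<beta> (h + k) m"
    using kneading_entry_simps(3)[of "h + k" \<beta> m] by (simp add: add.commute add.left_commute)
  have IH: "theta \<beta> (a (h + 2 + k)) False m = theta \<beta> (a (h + 1)) True m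
    + (\<Sum>r=h..<h+k. N \<beta> r m) + (\<Sum>j=h+1..h+1+k. tw \<beta> j) * (theta_d \<beta> m - theta_c \<beta> m)"
    using Suc by simp
  show ?case
    unfolding step row IH by (simp add: algebra_simps)
qed

section \<open>The constant symbol matrix\<close>

lemma sum_symb:
  assumes "j \<in> laps"
  shows "(\<Sum>m<n. symb j m * v m) = v (lap_rank h j - 1)"
proof -
  have "(\<Sum>m<n. symb j m * v m) = (\<Sum>m<n. if m = lap_rank h j - 1 then v m else 0)"
    using assms hole_inside by (intro sum.cong) (auto simp: symb_def lap_rank_def)
  also have "\<dots> = v (lap_rank h j - 1)"
    using assms hole_inside by (auto simp: lap_rank_def)
  finally show ?thesis .
qed

text \<open>The value at \<open>t = 0\<close> of the kneading matrix after its two hole rows have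
  been replaced by the coordinates at \<open>c+\<close> and \<open>d-\<close>.\<close>

definition symbol_rows :: "nat \<Rightarrow> nat \<Rightarrow> int" where
  "symbol_rows r m = (if r = h - 2 then symb 1 m else if r = h - 1 then symb (n + 1) m
     else symb (r + 2) m - symb (r + 1) m)"

text \<open>A kernel vector vanishes at the first and the last lap because of the two hole rows. The
  other rows equate its values at neighbouring laps on the same side of the hole, so the zeros
  spread from both ends up to the hole.\<close>

lemma fdet_symbol_rows: "fdet n symbol_rows \<noteq> 0"
proof
  assume "fdet n symbol_rows = 0"
  then have "Determinant.det (mat n n (\<lambda>(i, j). symbol_rows i j)) = 0"
    by (simp add: fdet_eq_det)
  then obtain v where v: "v \<in> carrier_vec n" "v \<noteq> 0\<^sub>v n"
      "mat n n (\<lambda>(i, j). symbol_rows i j) *\<^sub>v v = 0\<^sub>v n"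
    using det_0_iff_vec_prod_zero[of "mat n n (\<lambda>(i, j). symbol_rows i j)" n] by auto
  define y where "y j = vec_index v (lap_rank h j - 1)" for j
  have row: "(\<Sum>m<n. symbol_rows r m * vec_index v m) = 0" if "r < n" for r
  proof -
    have "(\<Sum>m<n. symbol_rows r m * vec_index v m)
        = vec_index (mat n n (\<lambda>(i, j). symbol_rows i j) *\<^sub>v v) r"
      using v(1) that by (simp add: scalar_prod_def atLeast0LessThan)
    also have "\<dots> = 0" using v(3) that by simp
    finally show ?thesis .
  qed
  have lap1: "1 \<in> laps" "n + 1 \<in> laps" using hole_inside by auto
  have y1: "y 1 = 0"
    using row[of "h - 2"] sum_symb[OF lap1(1), of "vec_index v"] hole_inside
    by (simp add: symbol_rows_def y_def)
  have "h - Suc 0 \<noteq> h - 2" "h - Suc 0 < n" using hole_inside by auto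
  then have yn: "y (n + 1) = 0"
    using row[of "h - 1"] sum_symb[OF lap1(2), of "vec_index v"]
    by (simp add: symbol_rows_def y_def)
  have ystep: "y (r + 2) = y (r + 1)" if "r < n" "r + 2 \<noteq> h" "r + 1 \<noteq> h" for r
  proof -
    have l: "r + 2 \<in> laps" "r + 1 \<in> laps" "r \<noteq> h - 2" "r \<noteq> h - 1"
      using that hole_inside by auto
    have "(\<Sum>m<n. symbol_rows r m * vec_index v m)
        = (\<Sum>m<n. symb (r + 2) m * vec_index v m) - (\<Sum>m<n. symb (r + 1) m * vec_index v m)"
      using l by (simp add: symbol_rows_def left_diff_distrib sum_subtractf)
    then show ?thesis
      using row[OF that(1)] sum_symb[OF l(1), of "vec_index v"] sum_symb[OF l(2), of "vec_index v"]
      by (simp add: y_def)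
  qed
  have left: "y (k + 1) = 0" if "k + 1 < h" for k
    using that
  proof (induction k)
    case (Suc k)
    then show ?case using ystep[of k] hole_inside by auto
  qed (use y1 in simp)
  \<comment> \<open>Counting down from the last lap makes the induction run towards the
    hole.\<close>
  have right: "y (n + 1 - k) = 0" if "h < n + 1 - k" for k
    using that
  proof (induction k)
    case (Suc k)
    then show ?case using ystep[of "n - 1 - k"] hole_inside
      by (auto simp: Suc_diff_Suc Suc_diff_le numeral_2_eq_2)
  qed (use yn in simp)
  have "vec_index v m = 0" if "m < n" for m
  proof (cases "m + 1 < h")
    case True
    then show ?thesis using left[of m] by (simp add: y_def lap_rank_def)
  next
    case False
    then show ?thesis using right[of "n - 1 - m"] that by (simp add: y_def lap_rank_def)
  qed
  then have "v = 0\<^sub>v n" using v(1) by (intro eq_vecI) auto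
  then show False using v(2) by simp
qed

section \<open>Factorisation of the kneading determinant\<close>

definition weight :: "real \<Rightarrow> real" where
  "weight \<beta> = (\<Sum>i<n. \<bar>\<rho> i\<bar> powr \<beta>)"

lemma sum_tw: "(\<Sum>j=1..h-1. tw \<beta> j) + (\<Sum>j=h+1..n+1. tw \<beta> j) = fps_const (weight \<beta>) * fps_X"
proof -
  have "laps = {1..h-1} \<union> {h+1..n+1}" using hole_inside by auto
  then have "(\<Sum>j=1..h-1. tw \<beta> j) + (\<Sum>j=h+1..n+1. tw \<beta> j) = (\<Sum>j\<in>laps. tw \<beta> j)"
    by (simp add: sum.union_disjoint)
  also have "\<dots> = (\<Sum>i<n. fps_const (\<bar>\<rho> i\<bar> powr \<beta>) * fps_X)"
    unfolding tw_def by (rule sum.reindex_bij_betw[OF bij_lap])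
  also have "\<dots> = fps_const (weight \<beta>) * fps_X"
    by (rule fps_ext) (simp add: weight_def fps_sum_nth)
  finally show ?thesis .
qed

lemma rows_span_theta:
  "theta_c \<beta> m + (\<Sum>j=1..h-1. tw \<beta> j) * (theta_d \<beta> m - theta_c \<beta> m) = N \<beta> (h - 2) m - (\<Sum>r<h-2. N \<beta> r m)"
  "theta_d \<beta> m - (\<Sum>j=h+1..n+1. tw \<beta> j) * (theta_d \<beta> m - theta_c \<beta> m) = N \<beta> (h - 1) m + (\<Sum>r=h..<n. N \<beta> r m)"
proof -
  have h: "h - 2 + 2 = h" "h - 2 + 1 = h - 1" "h - 2 < h - 1"
    "h + 2 + (n - h) = n + 2" "h + (n - h) = n" "h + 1 + (n - h) = n + 1"
    using hole_inside by auto
  show "theta_c \<beta> m + (\<Sum>j=1..h-1. tw \<beta> j) * (theta_d \<beta> m - theta_c \<beta> m)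
      = N \<beta> (h - 2) m - (\<Sum>r<h-2. N \<beta> r m)"
    using left_rows_sum[OF h(3), of \<beta> m] unfolding h kneading_entry_simps by (simp add: algebra_simps)
  show "theta_d \<beta> m - (\<Sum>j=h+1..n+1. tw \<beta> j) * (theta_d \<beta> m - theta_c \<beta> m)
      = N \<beta> (h - 1) m + (\<Sum>r=h..<n. N \<beta> r m)"
    using right_rows_sum[of "n - h" \<beta> m] unfolding h kneading_entry_simps a_ends
    by (simp add: algebra_simps)
qed

text \<open>With \<open>A\<close>, \<open>B\<close> the coordinates at \<open>c+\<close>,
  \<open>d-\<close> and \<open>Wl\<close>, \<open>Wr\<close> the total \<open>tw\<close> on either
  side of the hole, row operations turn the hole rows into \<open>(1 - Wl) A + Wl B\<close> and
  \<open>Wr A + (1 - Wr) B\<close>. The determinant of these coefficients is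
  \<open>1 - (Wl + Wr)\<close>, since the products cancel.\<close>

lemma fdet_N_eq_fdet_theta_rows:
  "fdet n (N \<beta>) = (1 - fps_const (weight \<beta>) * fps_X) *
     fdet n (\<lambda>r m. if r = h - 2 then theta_c \<beta> m else if r = h - 1 then theta_d \<beta> m else N \<beta> r m)"
proof -
  define u v where "u = h - 2" and "v = h - 1"
  have uv: "u < n" "v < n" "u \<noteq> v" "u < v" "{h..<n} = {v<..<n}"
    using hole_inside by (auto simp: u_def v_def)
  define Wl Wr where "Wl = (\<Sum>j=1..h-1. tw \<beta> j)" and "Wr = (\<Sum>j=h+1..n+1. tw \<beta> j)"
  define A B where "A = theta_c \<beta>" and "B = theta_d \<beta>"
  define g1 where "g1 = (\<lambda>i. if i = u then \<lambda>m. A m + Wl * (B m - A m) else N \<beta> i)"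
  define g3 where "g3 = (\<lambda>r m. if r = u then A m else if r = v then B m else N \<beta> r m)"
  have "fdet n g1 = (if u = u then 1 else if u < u then -1 else 0) * fdet n (N \<beta>)"
    unfolding g1_def
  proof (rule fdet_replace_row[OF uv(1), where x = "\<lambda>r. if r = u then 1 else if r < u then -1 else 0"])
    fix m
    have "(\<Sum>l<n. (if l = u then 1 else if l < u then -1 else 0) * N \<beta> l m)
        = (\<Sum>l<n. (if l = u then N \<beta> l m else 0) + (if l \<in> {..<u} then - N \<beta> l m else 0))"
      by (intro sum.cong) auto
    also have "\<dots> = N \<beta> u m + (\<Sum>l\<in>{..<n} \<inter> {..<u}. - N \<beta> l m)"
      using uv by (simp add: sum.distrib sum.inter_restrict)
    also have "{..<n} \<inter> {..<u} = {..<u}" using uv by auto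
    finally show "A m + Wl * (B m - A m)
        = (\<Sum>l<n. (if l = u then 1 else if l < u then -1 else 0) * N \<beta> l m)"
      using rows_span_theta(1)[of \<beta> m] by (simp add: A_def B_def Wl_def u_def sum_negf)
  qed
  then have d1: "fdet n g1 = fdet n (N \<beta>)" by simp
  have "fdet n (\<lambda>i. if i = v then \<lambda>m. B m - Wr * (B m - A m) else g1 i)
      = (if v = v then 1 else if v < v then 1 else 0) * fdet n g1"
  proof (rule fdet_replace_row[OF uv(2), where x = "\<lambda>r. if r = v then 1 else if v < r then 1 else 0"])
    fix m
    have "(\<Sum>l<n. (if l = v then 1 else if v < l then 1 else 0) * g1 l m)
        = (\<Sum>l<n. (if l = v then N \<beta> l m else 0) + (if l \<in> {v<..<n} then N \<beta> l m else 0))"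
      using uv by (intro sum.cong) (auto simp: g1_def)
    also have "\<dots> = N \<beta> v m + (\<Sum>l\<in>{..<n} \<inter> {v<..<n}. N \<beta> l m)"
      using uv by (simp add: sum.distrib sum.inter_restrict)
    also have "{..<n} \<inter> {v<..<n} = {h..<n}" using uv by auto
    finally show "B m - Wr * (B m - A m)
        = (\<Sum>l<n. (if l = v then 1 else if v < l then 1 else 0) * g1 l m)"
      using rows_span_theta(2)[of \<beta> m] by (simp add: A_def B_def Wr_def v_def)
  qed
  then have "fdet n (N \<beta>) = fdet n (\<lambda>i. if i = v then \<lambda>m. B m - Wr * (B m - A m) else g1 i)"
    using d1 by simp
  also have "\<dots> = fdet n (\<lambda>i j. if i = u then (1 - Wl) * g3 u j + Wl * g3 v j
      else if i = v then Wr * g3 u j + (1 - Wr) * g3 v j else g3 i j)"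
    using uv by (intro fdet_cong) (auto simp: g1_def g3_def algebra_simps)
  also have "\<dots> = ((1 - Wl) * (1 - Wr) - Wl * Wr) * fdet n g3"
  proof (rule fdet_two_row_comb)
    have "fps_nth (1 - Wl) 0 = 1"
      by (simp add: Wl_def tw_def fps_sum_nth)
    then show "1 - Wl \<noteq> 0" by auto
  qed (use uv in auto)
  also have "(1 - Wl) * (1 - Wr) - Wl * Wr = 1 - (Wl + Wr)" by (simp add: algebra_simps)
  also have "Wl + Wr = fps_const (weight \<beta>) * fps_X" unfolding Wl_def Wr_def by (rule sum_tw)
  finally show ?thesis unfolding g3_def A_def B_def u_def v_def .
qed

text \<open>Every row away from the hole is a difference of symbols plus multiples of the two
  coordinate rows, and those multiples can be subtracted. Then the coordinate rows are traded for
  the first and last symbols through the linear system that they satisfy, at the price of its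
  determinant \<open>P\<close>.\<close>

lemma fdet_theta_rows_eq_fdet_symbol_rows:
  obtains P :: "real poly" where
    "fdet n (\<lambda>r m. if r = h - 2 then theta_c \<beta> m else if r = h - 1 then theta_d \<beta> m else N \<beta> r m)
       * fps_of_poly P = of_int (fdet n symbol_rows)"
proof -
  define u v where "u = h - 2" and "v = h - 1"
  have uv: "u < n" "v < n" "u \<noteq> v" "u < v"
    using hole_inside by (auto simp: u_def v_def)
  define A B where "A = theta_c \<beta>" and "B = theta_d \<beta>"
  define g4 where "g4 = (\<lambda>r m. if r = u then A m else if r = v then B m
    else of_int (symb (r + 2) m - symb (r + 1) m) :: real fps)"
  define x where "x r = (if 0 < \<rho> (lap (r + 2)) then tw \<beta> (r + 2) else 0)
    + (if 0 < \<rho> (lap (r + 1)) then 0 else tw \<beta> (r + 1))" for r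
  define y where "y r = (if 0 < \<rho> (lap (r + 2)) then 0 else - tw \<beta> (r + 2))
    + (if 0 < \<rho> (lap (r + 1)) then - tw \<beta> (r + 1) else 0)" for r
  have Nrow: "N \<beta> r m = of_int (symb (r + 2) m - symb (r + 1) m) + x r * A m + y r * B m"
    if "r < n" "r \<noteq> u" "r \<noteq> v" for r m
  proof -
    have r: "r + 2 \<in> laps" "r + 1 \<in> laps" "r + 2 \<noteq> h" "r + 1 \<noteq> h"
      using that hole_inside by (auto simp: u_def v_def)
    have "theta \<beta> (a (r + 2)) False m = of_int (symb (r + 1) m)
      + (if 0 < \<rho> (lap (r + 1)) then tw \<beta> (r + 1) * B m else - tw \<beta> (r + 1) * A m)"
      using theta_left[OF r(2), of \<beta> m] by (simp add: A_def B_def)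
    then show ?thesis
      using theta_right[OF r(1), of \<beta> m] kneading_entry_simps(3)[OF r(3,4), of \<beta> m]
      by (auto simp: x_def y_def A_def B_def algebra_simps)
  qed
  have "fdet n (\<lambda>r m. if r = u then A m else if r = v then B m else N \<beta> r m)
      = fdet n (\<lambda>i j. if i \<in> {..<n} - {u, v} then g4 i j + x i * g4 u j + y i * g4 v j else g4 i j)"
    using uv by (intro fdet_cong) (auto simp: g4_def Nrow)
  also have "\<dots> = fdet n g4"
    using uv by (intro fdet_add_two_rows) auto
  finally have d3: "fdet n (\<lambda>r m. if r = u then A m else if r = v then B m else N \<beta> r m) = fdet n g4" .
  have lap1: "1 \<in> laps" "n + 1 \<in> laps" using hole_inside by auto
  \<comment> \<open>Coefficients of the equations at \<open>c+\<close> and \<open>d-\<close> solved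
    for their symbols. An increasing outer lap fixes its outer end; a decreasing one sends it to the
    opposite end.\<close>
  define m11 m12 m21 m22 where
    "m11 = (if 0 < \<rho> (lap 1) then 1 - tw \<beta> 1 else 1)" and
    "m12 = (if 0 < \<rho> (lap 1) then 0 else tw \<beta> 1)" and
    "m21 = (if 0 < \<rho> (lap (n + 1)) then 0 else tw \<beta> (n + 1))" and
    "m22 = (if 0 < \<rho> (lap (n + 1)) then 1 - tw \<beta> (n + 1) else 1)"
  have first: "of_int (symb (Suc 0) m) = m11 * A m + m12 * B m" for m
    using theta_right[OF lap1(1), of \<beta> m] unfolding a_ends
    by (auto simp: m11_def m12_def A_def B_def algebra_simps)
  have last: "of_int (symb (Suc n) m) = m21 * A m + m22 * B m" for m
    using theta_left[OF lap1(2), of \<beta> m] a_ends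
    by (auto simp: m21_def m22_def A_def B_def algebra_simps)
  have "of_int (fdet n symbol_rows) = fdet n (\<lambda>r m. of_int (symbol_rows r m) :: real fps)"
    by (simp add: fdet_def)
  also have "\<dots> = fdet n (\<lambda>r m. of_int (if r = u then symb 1 m else if r = v then symb (n + 1) m
      else symb (r + 2) m - symb (r + 1) m))"
    unfolding symbol_rows_def u_def v_def ..
  also have "\<dots> = fdet n (\<lambda>i j. if i = u then m11 * g4 u j + m12 * g4 v j
      else if i = v then m21 * g4 u j + m22 * g4 v j else g4 i j)"
    using uv by (intro fdet_cong)
      (auto simp: g4_def first last)
  also have "\<dots> = (m11 * m22 - m12 * m21) * fdet n g4"
  proof (rule fdet_two_row_comb)
    have "fps_nth m11 0 = 1" by (simp add: m11_def tw_def)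
    then show "m11 \<noteq> 0" by auto
  qed (use uv in auto)
  finally have d4: "of_int (fdet n symbol_rows) = (m11 * m22 - m12 * m21) * fdet n g4" .
  have tw_poly: "tw \<beta> j = fps_of_poly [:0, \<bar>\<rho> (lap j)\<bar> powr \<beta>:]" for j
    by (simp add: tw_def fps_of_poly_pCons)
  have "m11 \<in> range fps_of_poly" "m12 \<in> range fps_of_poly"
    "m21 \<in> range fps_of_poly" "m22 \<in> range fps_of_poly"
    unfolding m11_def m12_def m21_def m22_def tw_poly
    by (auto simp flip: fps_of_poly_1 fps_of_poly_diff fps_of_poly_0)
  then obtain P11 P12 P21 P22 where "m11 = fps_of_poly P11" "m12 = fps_of_poly P12"
    "m21 = fps_of_poly P21" "m22 = fps_of_poly P22" by blast
  then have det: "m11 * m22 - m12 * m21 = fps_of_poly (P11 * P22 - P12 * P21)"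
    by (simp add: fps_of_poly_mult fps_of_poly_diff)
  show ?thesis
    using d3 unfolding A_def B_def u_def v_def
    by (intro that[of "P11 * P22 - P12 * P21"]) (simp only: d4 det mult.commute)
qed

text \<open>At a zero of the determinant the left side of the product identity vanishes whatever
  \<open>P\<close> is there, and the nonzero integer can be cancelled on the right.\<close>

theorem kneading_det_zero:
  assumes "fps_value_at (kneading_det n \<rho> \<rho>' a h \<beta>) t 0"
  shows "t * weight \<beta> = 1"
proof -
  obtain P where P: "fdet n (\<lambda>r m. if r = h - 2 then theta_c \<beta> m else if r = h - 1 then theta_d \<beta> m
      else N \<beta> r m) * fps_of_poly P = of_int (fdet n symbol_rows)" (is "?D * _ = _")
    by (rule fdet_theta_rows_eq_fdet_symbol_rows)
  define Q where "Q = Polynomial.smult (of_int (fdet n symbol_rows)) [:1, - weight \<beta>:]"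
  have "kneading_det n \<rho> \<rho>' a h \<beta> = (1 - fps_const (weight \<beta>) * fps_X) * ?D"
    using fdet_N_eq_fdet_theta_rows[of \<beta>] by (simp add: kneading_det_def fdet_def)
  then have "kneading_det n \<rho> \<rho>' a h \<beta> * fps_of_poly P
      = of_int (fdet n symbol_rows) * (1 - fps_const (weight \<beta>) * fps_X)"
    using P by (simp add: mult.assoc mult.commute)
  also have "\<dots> = fps_of_poly Q"
    by (simp add: Q_def fps_of_poly_pCons fps_of_poly_smult fps_of_int right_diff_distrib
        mult.assoc flip: fps_const_mult fps_const_neg)
  finally have "poly Q t = 0"
    using fps_value_at_mult_poly[OF assms] by simp
  then have "of_int (fdet n symbol_rows) * (1 - t * weight \<beta>) = 0"
    by (simp add: Q_def)
  then show ?thesis using fdet_symbol_rows by simp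
qed

section \<open>Hausdorff dimension of the attractor\<close>

lemma f_in_lap:
  assumes "j \<in> laps" "x \<in> {c<..<d}"
  shows "a j < f (lap j) x" "f (lap j) x < a (Suc j)"
proof -
  have "\<rho> (lap j) \<noteq> 0" using lap_image(1)[OF assms(1)] rho_nz by auto
  then consider "0 < \<rho> (lap j)" | "\<rho> (lap j) < 0" by linarith
  then have "a j < f (lap j) x \<and> f (lap j) x < a (Suc j)"
  proof cases
    case 1
    then have "f (lap j) c < f (lap j) x" "f (lap j) x < f (lap j) d"
      using assms by (auto simp: aff_def)
    then show ?thesis using lap_ends[OF assms(1)] 1 by simp
  next
    case 2
    then have "f (lap j) x < f (lap j) c" "f (lap j) d < f (lap j) x"
      using assms by (auto simp: aff_def)
    then show ?thesis using lap_ends[OF assms(1)] 2 by simp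
  qed
  then show "a j < f (lap j) x" "f (lap j) x < a (Suc j)" by auto
qed

lemma index_set_ne: "{..<n} \<noteq> {}"
  using n_ge by (simp add: lessThan_empty_iff)

lemma f_maps_I: "i < n \<Longrightarrow> f i ` {c..d} \<subseteq> {c..d}"
  using cover by blast

lemma f_maps_Ioo: "i < n \<Longrightarrow> x \<in> {c<..<d} \<Longrightarrow> f i x \<in> {c<..<d}"
proof -
  assume "i < n" and x: "x \<in> {c<..<d}"
  obtain j where j: "j \<in> laps" "i = lap j" using lap_cases[OF \<open>i < n\<close>] by metis
  then have "c \<le> a j" "a (Suc j) \<le> d" using a_le[of 1 j] a_le[of "Suc j" "n + 2"] a_ends by auto
  then show "f i x \<in> {c<..<d}" using f_in_lap[OF j(1) x] j by auto
qed

lemma dist_f: "dist (f i x) (f i y) = \<bar>\<rho> i\<bar> * dist x y"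
  by (simp add: aff_def dist_real_def abs_mult flip: right_diff_distrib)

definition rmax :: real where "rmax = Max ((\<lambda>i. \<bar>\<rho> i\<bar>) ` {..<n})"

lemma rmax: "i < n \<Longrightarrow> \<bar>\<rho> i\<bar> \<le> rmax" "0 < rmax" "rmax < 1"
proof -
  have ne: "finite ((\<lambda>i. \<bar>\<rho> i\<bar>) ` {..<n})" "(\<lambda>i. \<bar>\<rho> i\<bar>) ` {..<n} \<noteq> {}" using index_set_ne by auto
  show "i < n \<Longrightarrow> \<bar>\<rho> i\<bar> \<le> rmax" using ne unfolding rmax_def by (intro Max_ge) auto
  have "rmax \<in> (\<lambda>i. \<bar>\<rho> i\<bar>) ` {..<n}" unfolding rmax_def using ne by (rule Max_in)
  then show "0 < rmax" "rmax < 1" using contr by auto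
qed

lemma rmax_power_tendsto: "(\<lambda>k. rmax ^ k * M) \<longlonglongrightarrow> 0"
  using rmax by (intro tendsto_mult_left_zero LIMSEQ_power_zero) auto

text \<open>Each point of \<open>A\<close> has preimages in \<open>A\<close> of every order, and
  each application of a branch contracts the distance to \<open>K\<close> by at least
  \<open>rmax\<close>. It is applied to \<open>E\<close> inside the interval and to the two ends
  inside \<open>E\<close>.\<close>

lemma subset_of_invariant:
  assumes A: "bounded A" "A \<subseteq> (\<Union>i<n. f i ` A)"
    and K: "closed K" "K \<noteq> {}" "\<And>i. i < n \<Longrightarrow> f i ` K \<subseteq> K"
  shows "A \<subseteq> K"
proof -
  obtain z where z: "z \<in> K" using K by auto
  obtain M where M: "\<And>x. x \<in> A \<Longrightarrow> dist z x \<le> M"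
    using A(1) by (metis bounded_any_center)
  have close: "infdist x K \<le> rmax ^ k * M" if "x \<in> A" for x k
    using that
  proof (induction k arbitrary: x)
    case 0
    then show ?case using infdist_le[OF z, of x] M[of x] by (simp add: dist_commute)
  next
    case (Suc k)
    obtain i y where i: "i < n" "y \<in> A" "x = f i y" using A(2) Suc.prems by auto
    obtain w where w: "w \<in> K" "infdist y K = dist y w"
      using infdist_attains_inf[OF K(1,2)] by blast
    have "infdist x K \<le> dist (f i y) (f i w)"
      using K(3)[OF i(1)] w i(3) by (intro infdist_le2[of "f i w"]) auto
    also have "\<dots> = \<bar>\<rho> i\<bar> * infdist y K" using w by (simp add: dist_f)
    also have "\<dots> \<le> rmax * (rmax ^ k * M)"
      using Suc.IH[OF i(2)] rmax(1)[OF i(1)] rmax(2) infdist_nonneg by (intro mult_mono) auto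
    finally show ?case by (simp add: mult.assoc)
  qed
  show ?thesis
  proof
    fix x assume "x \<in> A"
    then have "infdist x K \<le> 0"
      using close by (intro LIMSEQ_le_const[OF rmax_power_tendsto]) auto
    then show "x \<in> K" using K in_closed_iff_infdist_zero infdist_nonneg by (metis order_antisym)
  qed
qed

text \<open>The length of the shortest lap or hole: an interval shorter than this contains at most
  one of the endpoints \<open>a e\<close>.\<close>

definition gap :: real where "gap = Min ((\<lambda>j. a (Suc j) - a j) ` {1..n+1})"

lemma gap: "0 < gap" "1 \<le> j \<Longrightarrow> j \<le> n + 1 \<Longrightarrow> gap \<le> a (Suc j) - a j"
proof -
  have "gap \<in> (\<lambda>j. a (Suc j) - a j) ` {1..n+1}" unfolding gap_def by (rule Min_in) auto
  then show "0 < gap" using a_mono by auto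
  show "1 \<le> j \<Longrightarrow> j \<le> n + 1 \<Longrightarrow> gap \<le> a (Suc j) - a j" unfolding gap_def by (rule Min_le) auto
qed

lemma gap_le: "gap \<le> d - c"
  using gap(2)[of 1] a_le[of 2 "n + 2"] a_ends by (simp add: numeral_2_eq_2)

section \<open>Cylinder masses and their interval bound\<close>

lemma weight_pos: "0 < weight \<beta>"
  unfolding weight_def using index_set_ne contr by (intro sum_pos) auto

lemma weight_zero: "weight 0 = real n"
proof -
  have "weight 0 = (\<Sum>i<n. 1)"
    unfolding weight_def using contr by (intro sum.cong) auto
  then show ?thesis by simp
qed

lemma weight_strict_antimono: "s < t \<Longrightarrow> weight t < weight s"
  unfolding weight_def using index_set_ne contr by (intro sum_strict_mono powr_less_mono') auto

text \<open>Total weight of the level-\<open>k\<close> cylinders contained in \<open>J\<close>: a finite-level substitute for the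
  self-similar measure.\<close>
primrec mass :: "real \<Rightarrow> nat \<Rightarrow> real set \<Rightarrow> real" where
  "mass \<beta> 0 J = (if {c..d} \<subseteq> J then 1 else 0)"
| "mass \<beta> (Suc k) J = (\<Sum>i<n. \<bar>\<rho> i\<bar> powr \<beta> * mass \<beta> k (f i -` J))"

lemma mass_nonneg: "0 \<le> mass \<beta> k J"
  by (induction k arbitrary: J) (auto intro!: sum_nonneg)

lemma mass_mono: "J \<subseteq> J' \<Longrightarrow> mass \<beta> k J \<le> mass \<beta> k J'"
proof (induction k arbitrary: J J')
  case (Suc k)
  then show ?case by (auto intro!: sum_mono mult_left_mono Suc.IH)
qed auto

lemma mass_le_1: "weight \<beta> = 1 \<Longrightarrow> mass \<beta> k J \<le> 1"
proof (induction k arbitrary: J)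
  case (Suc k)
  have "mass \<beta> (Suc k) J \<le> (\<Sum>i<n. \<bar>\<rho> i\<bar> powr \<beta> * 1)"
    using Suc unfolding mass.simps by (intro sum_mono mult_left_mono) auto
  then show ?case using Suc.prems by (simp add: weight_def)
qed auto

text \<open>A counted cylinder contains interior points of the interval, since the branches preserve
  the open interval. Hence a set meeting a lap only in its endpoints gets nothing from that
  lap.\<close>

lemma mass_eq_0: "J \<inter> {c<..<d} = {} \<Longrightarrow> mass \<beta> k J = 0"
proof (induction k arbitrary: J)
  case 0
  have "(c + d) / 2 \<in> {c<..<d}" using I_nontriv by auto
  then have "(c + d) / 2 \<notin> J" "(c + d) / 2 \<in> {c..d}" using 0 by auto
  then show ?case by (metis mass.simps(1) subsetD)
next
  case (Suc k)
  have "f i -` J \<inter> {c<..<d} = {}" if "i < n" for i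
    using f_maps_Ioo[OF that] Suc.prems by blast
  then show ?case using Suc.IH by simp
qed

abbreviation lap_mass :: "real \<Rightarrow> nat \<Rightarrow> real set \<Rightarrow> nat \<Rightarrow> real" where
  "lap_mass \<beta> k J j \<equiv> \<bar>\<rho> (lap j)\<bar> powr \<beta> * mass \<beta> k (f (lap j) -` J)"

lemma mass_Suc: "mass \<beta> (Suc k) J = (\<Sum>j\<in>laps. lap_mass \<beta> k J j)"
  unfolding mass.simps
  by (rule sum.reindex_bij_betw[OF bij_lap, of "\<lambda>i. \<bar>\<rho> i\<bar> powr \<beta> * mass \<beta> k (f i -` J)", symmetric])

lemma mass_Suc_single:
  assumes "j \<in> laps" "\<And>l. l \<in> laps - {j} \<Longrightarrow> lap_mass \<beta> k J l = 0"
  shows "mass \<beta> (Suc k) J = lap_mass \<beta> k J j"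
proof -
  have "(\<Sum>l\<in>laps. lap_mass \<beta> k J l) = (\<Sum>l\<in>{j}. lap_mass \<beta> k J l)"
    using assms by (intro sum.mono_neutral_right) blast+
  then show ?thesis unfolding mass_Suc by simp
qed

lemma lap_mass_eq_0:
  assumes "j \<in> laps" "J \<inter> {a j<..<a (Suc j)} = {}"
  shows "lap_mass \<beta> k J j = 0"
proof -
  have "f (lap j) -` J \<inter> {c<..<d} = {}"
    using f_in_lap[OF assms(1)] assms(2) by (auto simp: greaterThanLessThan_def)
  then show ?thesis by (simp add: mass_eq_0)
qed

lemma vimage_f:
  assumes "i < n"
  shows "0 < \<rho> i \<Longrightarrow> f i -` {..y} = {..(y - \<rho>' i) / \<rho> i}"
    "0 < \<rho> i \<Longrightarrow> f i -` {x..} = {(x - \<rho>' i) / \<rho> i..}"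
    "\<rho> i < 0 \<Longrightarrow> f i -` {..y} = {(y - \<rho>' i) / \<rho> i..}"
    "\<rho> i < 0 \<Longrightarrow> f i -` {x..} = {..(x - \<rho>' i) / \<rho> i}"
  by (auto simp: aff_def field_simps)

context
  fixes \<beta> :: real
  assumes \<beta>_pos: "0 < \<beta>" and w1: "weight \<beta> = 1"
begin

text \<open>Chosen so that the bounds below exceed 1, and so hold trivially, for lengths of at least
  \<open>gap\<close>.\<close>

definition mass_const :: real where "mass_const = gap powr (- \<beta>)"

lemma mass_const_pos: "0 < mass_const"
  using gap by (simp add: mass_const_def)

lemma mass_const_ge: "gap \<le> z \<Longrightarrow> 1 \<le> mass_const * z powr \<beta>"
proof -
  assume "gap \<le> z"
  then have "gap powr \<beta> \<le> z powr \<beta>" using gap \<beta>_pos by (intro powr_mono2) auto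
  then have "mass_const * gap powr \<beta> \<le> mass_const * z powr \<beta>"
    using mass_const_pos by simp
  moreover have "mass_const * gap powr \<beta> = 1"
    using gap by (simp add: mass_const_def flip: powr_add)
  ultimately show ?thesis by simp
qed

text \<open>Half-lines are the pieces left when an interval is cut at an endpoint. A decreasing
  branch reverses them, so both directions have to be carried through one induction.\<close>

definition one_sided :: "nat \<Rightarrow> bool" where
  "one_sided k \<longleftrightarrow> (\<forall>y\<ge>c. mass \<beta> k {..y} \<le> mass_const * (y - c) powr \<beta>) \<and>
     (\<forall>x\<le>d. mass \<beta> k {x..} \<le> mass_const * (d - x) powr \<beta>)"

lemma lap_mass_one_sided:
  assumes "one_sided k" "j \<in> laps"
  shows "a j \<le> y \<Longrightarrow> lap_mass \<beta> k {..y} j \<le> mass_const * (y - a j) powr \<beta>"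
    "x \<le> a (Suc j) \<Longrightarrow> lap_mass \<beta> k {x..} j \<le> mass_const * (a (Suc j) - x) powr \<beta>"
proof -
  let ?r = "\<rho> (lap j)" and ?r' = "\<rho>' (lap j)"
  have i: "lap j < n" by (rule lap_image(1)[OF assms(2)])
  have L: "mass \<beta> k {..y} \<le> mass_const * (y - c) powr \<beta>" if "c \<le> y" for y
    using assms(1) that unfolding one_sided_def by auto
  have R: "mass \<beta> k {x..} \<le> mass_const * (d - x) powr \<beta>" if "x \<le> d" for x
    using assms(1) that unfolding one_sided_def by auto
  have scale: "\<bar>?r\<bar> powr \<beta> * m \<le> mass_const * z powr \<beta>"
    if "m \<le> mass_const * (z / \<bar>?r\<bar>) powr \<beta>" "0 \<le> z" for m z
  proof -
    have "\<bar>?r\<bar> powr \<beta> * m \<le> \<bar>?r\<bar> powr \<beta> * (mass_const * (z / \<bar>?r\<bar>) powr \<beta>)"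
      using that by (intro mult_left_mono) auto
    then show ?thesis using powr_scale[of "\<bar>?r\<bar>" z \<beta> mass_const] rho_nz[OF i] that by simp
  qed
  have "?r \<noteq> 0" using rho_nz[OF i] .
  then consider "0 < ?r" | "?r < 0" by linarith
  note sgn = this
  show "lap_mass \<beta> k {..y} j \<le> mass_const * (y - a j) powr \<beta>" if y: "a j \<le> y"
  proof (rule scale)
    show "mass \<beta> k (f (lap j) -` {..y}) \<le> mass_const * ((y - a j) / \<bar>?r\<bar>) powr \<beta>"
    proof (cases rule: sgn)
      case 1
      then have e: "(y - ?r') / ?r - c = (y - a j) / \<bar>?r\<bar>"
        using lap_ends(1)[OF assms(2)] by (simp add: aff_def field_simps)
      have "0 \<le> (y - a j) / \<bar>?r\<bar>" using y by simp
      then have "c \<le> (y - ?r') / ?r" using e by linarith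
      from L[OF this] show ?thesis unfolding e vimage_f(1)[OF i 1] .
    next
      case 2
      then have e: "d - (y - ?r') / ?r = (y - a j) / \<bar>?r\<bar>"
        using lap_ends(3)[OF assms(2)] by (simp add: aff_def field_simps)
      have "0 \<le> (y - a j) / \<bar>?r\<bar>" using y by simp
      then have "(y - ?r') / ?r \<le> d" using e by linarith
      from R[OF this] show ?thesis unfolding e vimage_f(3)[OF i 2] .
    qed
  qed (use y in simp)
  show "lap_mass \<beta> k {x..} j \<le> mass_const * (a (Suc j) - x) powr \<beta>" if x: "x \<le> a (Suc j)"
  proof (rule scale)
    show "mass \<beta> k (f (lap j) -` {x..}) \<le> mass_const * ((a (Suc j) - x) / \<bar>?r\<bar>) powr \<beta>"
    proof (cases rule: sgn)
      case 1
      then have e: "d - (x - ?r') / ?r = (a (Suc j) - x) / \<bar>?r\<bar>"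
        using lap_ends(2)[OF assms(2)] by (simp add: aff_def field_simps)
      have "0 \<le> (a (Suc j) - x) / \<bar>?r\<bar>" using x by simp
      then have "(x - ?r') / ?r \<le> d" using e by linarith
      from R[OF this] show ?thesis unfolding e vimage_f(2)[OF i 1] .
    next
      case 2
      then have e: "(x - ?r') / ?r - c = (a (Suc j) - x) / \<bar>?r\<bar>"
        using lap_ends(4)[OF assms(2)] by (simp add: aff_def field_simps)
      have "0 \<le> (a (Suc j) - x) / \<bar>?r\<bar>" using x by simp
      then have "c \<le> (x - ?r') / ?r" using e by linarith
      from L[OF this] show ?thesis unfolding e vimage_f(4)[OF i 2] .
    qed
  qed (use x in simp)
qed

text \<open>A half-line reaching less than \<open>gap\<close> into the interval meets only the
  outermost lap. Pulling back through that lap preserves the bound without loss in the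
  constant.\<close>

lemma one_sided: "one_sided k"
proof (induction k)
  case 0
  have "mass \<beta> 0 {..y} \<le> mass_const * (y - c) powr \<beta>" if "c \<le> y" for y
    using mass_const_ge[of "y - c"] gap_le mass_const_pos I_nontriv by (auto simp: not_le)
  moreover have "mass \<beta> 0 {x..} \<le> mass_const * (d - x) powr \<beta>" if "x \<le> d" for x
    using mass_const_ge[of "d - x"] gap_le mass_const_pos I_nontriv by (auto simp: not_le)
  ultimately show ?case unfolding one_sided_def by blast
next
  case (Suc k)
  have lap1: "1 \<in> laps" "n + 1 \<in> laps" using hole_inside by auto
  have "mass \<beta> (Suc k) {..y} \<le> mass_const * (y - c) powr \<beta>" if "c \<le> y" for y
  proof (cases "gap \<le> y - c")
    case True
    then show ?thesis using mass_const_ge mass_le_1[OF w1, of "Suc k" "{..y}"] by fastforce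
  next
    case False
    have "lap_mass \<beta> k {..y} j = 0" if "j \<in> laps - {1}" for j
    proof (rule lap_mass_eq_0)
      have "a 2 \<le> a j" using a_le[of 2 j] that by auto
      then have "y < a j" using gap(2)[of 1] False a_ends by (simp add: numeral_2_eq_2)
      then show "{..y} \<inter> {a j<..<a (Suc j)} = {}" by auto
    qed (use that in auto)
    then have "mass \<beta> (Suc k) {..y} = lap_mass \<beta> k {..y} 1"
      by (rule mass_Suc_single[OF lap1(1)])
    then show ?thesis
      using lap_mass_one_sided(1)[OF Suc lap1(1), of y] a_ends that by simp
  qed
  moreover have "mass \<beta> (Suc k) {x..} \<le> mass_const * (d - x) powr \<beta>" if "x \<le> d" for x
  proof (cases "gap \<le> d - x")
    case True
    then show ?thesis using mass_const_ge mass_le_1[OF w1, of "Suc k" "{x..}"] by fastforce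
  next
    case False
    have "lap_mass \<beta> k {x..} j = 0" if "j \<in> laps - {n + 1}" for j
    proof (rule lap_mass_eq_0)
      have "a (Suc j) \<le> a (n + 1)" using a_le[of "Suc j" "n + 1"] that by auto
      then have "a (Suc j) < x" using gap(2)[of "n + 1"] False a_ends by simp
      then show "{x..} \<inter> {a j<..<a (Suc j)} = {}" by auto
    qed (use that in auto)
    then have "mass \<beta> (Suc k) {x..} = lap_mass \<beta> k {x..} (n + 1)"
      by (rule mass_Suc_single[OF lap1(2)])
    then show ?thesis
      using lap_mass_one_sided(2)[OF Suc lap1(2), of x] a_ends that by simp
  qed
  ultimately show ?case unfolding one_sided_def by blast
qed

text \<open>A short interval either contains one endpoint or none. In the first case at most two
  laps contribute, each bounded by a half-line, which is the origin of the factor 2. In the second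
  it meets the interior of at most one lap and is rescaled with unchanged constant, so the factor
  does not accumulate with the level.\<close>

lemma mass_interval: "x \<le> y \<Longrightarrow> mass \<beta> k {x..y} \<le> 2 * mass_const * (y - x) powr \<beta>"
proof (induction k arbitrary: x y)
  case 0
  show ?case
    using mass_const_ge[of "y - x"] gap_le mass_const_pos I_nontriv by (auto simp: not_le)
next
  case (Suc k)
  let ?J = "{x..y}"
  have pos: "0 \<le> mass_const * (y - x) powr \<beta>" using mass_const_pos by simp
  show ?case
  proof (cases "gap \<le> y - x")
    case True
    then show ?thesis using mass_const_ge mass_le_1[OF w1, of "Suc k" ?J] pos by fastforce
  next
    case small: False
    show ?thesis
    proof (cases "\<exists>e\<in>{1..n+2}. a e \<in> ?J")
      case True
      then obtain e where e: "1 \<le> e" "e \<le> n + 2" "x \<le> a e" "a e \<le> y" by auto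
      have "lap_mass \<beta> k ?J j = 0" if j: "j \<in> laps - {e - 1, e}" for j
      proof (rule lap_mass_eq_0)
        consider "e + 1 \<le> j" | "j + 2 \<le> e" using j by force
        then show "?J \<inter> {a j<..<a (Suc j)} = {}"
        proof cases
          case 1
          then have "a (Suc e) \<le> a j" using a_le[of "Suc e" j] e j by auto
          then have "y < a j" using gap(2)[of e] 1 j e small by auto
          then show ?thesis by auto
        next
          case 2
          then have "a (Suc j) \<le> a (e - 1)" using a_le[of "Suc j" "e - 1"] e j by auto
          then have "a (Suc j) < x" using gap(2)[of "e - 1"] 2 e small by (cases e) auto
          then show ?thesis by auto
        qed
      qed (use j in auto)
      \<comment> \<open>Intersecting with \<open>laps\<close> discards the hole and the fictitious
        positions \<open>0\<close> and \<open>n + 2\<close> that arise at the outer ends.\<close>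
      then have "mass \<beta> (Suc k) ?J = (\<Sum>j\<in>laps \<inter> {e - 1, e}. lap_mass \<beta> k ?J j)"
        unfolding mass_Suc by (intro sum.mono_neutral_right) blast+
      also have "\<dots> \<le> of_nat (card (laps \<inter> {e - 1, e})) * (mass_const * (y - x) powr \<beta>)"
      proof (rule sum_bounded_above)
        fix j assume j: "j \<in> laps \<inter> {e - 1, e}"
        then have jl: "j \<in> laps" by auto
        show "lap_mass \<beta> k ?J j \<le> mass_const * (y - x) powr \<beta>"
        proof (cases "j = e")
          case True
          have "lap_mass \<beta> k ?J j \<le> lap_mass \<beta> k {..y} j"
            by (intro mult_left_mono mass_mono) auto
          also have "\<dots> \<le> mass_const * (y - a e) powr \<beta>"
            using lap_mass_one_sided(1)[OF one_sided jl, of y] e True by simp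
          also have "\<dots> \<le> mass_const * (y - x) powr \<beta>"
            using e mass_const_pos \<beta>_pos by (intro mult_left_mono powr_mono2) auto
          finally show ?thesis .
        next
          case False
          then have "Suc j = e" using j by auto
          have "lap_mass \<beta> k ?J j \<le> lap_mass \<beta> k {x..} j"
            by (intro mult_left_mono mass_mono) auto
          also have "\<dots> \<le> mass_const * (a e - x) powr \<beta>"
            using lap_mass_one_sided(2)[OF one_sided jl, of x] e \<open>Suc j = e\<close> by simp
          also have "\<dots> \<le> mass_const * (y - x) powr \<beta>"
            using e mass_const_pos \<beta>_pos by (intro mult_left_mono powr_mono2) auto
          finally show ?thesis .
        qed
      qed
      also have "\<dots> \<le> 2 * (mass_const * (y - x) powr \<beta>)"
      proof (rule mult_right_mono)
        have "card (laps \<inter> {e - 1, e}) \<le> card {e - 1, e}" by (intro card_mono) auto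
        also have "\<dots> \<le> 2" by (simp add: card_insert_if)
        finally show "of_nat (card (laps \<inter> {e - 1, e})) \<le> (2 :: real)" by simp
      qed (rule pos)
      finally show ?thesis by simp
    next
      case False
      then have no_end: "a e < x \<or> y < a e" if "e \<in> {1..n+2}" for e using that by force
      show ?thesis
      proof (cases "\<exists>j\<in>laps. ?J \<inter> {a j<..<a (Suc j)} \<noteq> {}")
        case True
        then obtain j where j: "j \<in> laps" "?J \<inter> {a j<..<a (Suc j)} \<noteq> {}" by blast
        then have in_lap: "a j < x" "y < a (Suc j)"
          using no_end[of j] no_end[of "Suc j"] by auto
        have "lap_mass \<beta> k ?J l = 0" if l: "l \<in> laps - {j}" for l
        proof (rule lap_mass_eq_0)
          have "a (Suc j) \<le> a l \<or> a (Suc l) \<le> a j"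
            using a_le[of "Suc j" l] a_le[of "Suc l" j] l j by (cases l j rule: linorder_cases) auto
          then show "?J \<inter> {a l<..<a (Suc l)} = {}" using in_lap by auto
        qed (use l in auto)
        then have eq: "mass \<beta> (Suc k) ?J = lap_mass \<beta> k ?J j"
          by (rule mass_Suc_single[OF j(1)])
        let ?r = "\<rho> (lap j)" and ?r' = "\<rho>' (lap j)"
        have nz: "?r \<noteq> 0" using rho_nz lap_image(1)[OF j(1)] by auto
        obtain x' y' where v: "f (lap j) -` ?J = {x'..y'}" "x' \<le> y'" "y' - x' = (y - x) / \<bar>?r\<bar>"
        proof (cases "0 < ?r")
          case True
          then show ?thesis
            using Suc.prems
            by (intro that[of "(x - ?r') / ?r" "(y - ?r') / ?r"])
              (auto simp: aff_def field_simps)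
        next
          case False
          then have "?r < 0" using nz by simp
          then show ?thesis
            using Suc.prems
            by (intro that[of "(y - ?r') / ?r" "(x - ?r') / ?r"])
              (auto simp: aff_def field_simps)
        qed
        have "lap_mass \<beta> k ?J j \<le> \<bar>?r\<bar> powr \<beta> * (2 * mass_const * ((y - x) / \<bar>?r\<bar>) powr \<beta>)"
          using Suc.IH[OF v(2)] v by (intro mult_left_mono) auto
        then show ?thesis
          using powr_scale[of "\<bar>?r\<bar>" "y - x" \<beta> "2 * mass_const"] nz Suc.prems eq by simp
      next
        case False
        then have "mass \<beta> (Suc k) ?J = 0"
          unfolding mass_Suc using lap_mass_eq_0[of _ ?J \<beta> k] by (intro sum.neutral) blast
        then show ?thesis using pos by simp
      qed
    qed
  qed
qed

end

end

lemma subset_interval_diameter: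
  fixes U :: "real set"
  assumes "bounded U"
  obtains x where "U \<subseteq> {x..x + diameter U}"
proof (cases "U = {}")
  case False
  have bdd: "bdd_below U" using assms by (rule bounded_imp_bdd_below)
  have "Inf U \<le> y" "y \<le> Inf U + diameter U" if "y \<in> U" for y
  proof -
    show "Inf U \<le> y" using bdd that by (rule cInf_lower[rotated])
    have "y - diameter U \<le> z" if "z \<in> U" for z
      using diameter_bounded_bound[OF assms \<open>y \<in> U\<close> that] by (simp add: dist_real_def)
    then have "y - diameter U \<le> Inf U" using False by (intro cInf_greatest) auto
    then show "y \<le> Inf U + diameter U" by simp
  qed
  then show thesis by (intro that[of "Inf U"]) auto
qed (use that in auto)

locale holed_ifs_attractor = holed_ifs +
  fixes E :: "real set"
  assumes E_compact: "compact E" and E_ne: "E \<noteq> {}" and E_eq: "E = (\<Union>i<n. f i ` E)"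
begin

lemma E_subset_I: "E \<subseteq> {c..d}"
proof (rule subset_of_invariant[OF compact_imp_bounded[OF E_compact] equalityD1[OF E_eq]])
  show "{c..d} \<noteq> {}" using I_nontriv by simp
qed (use f_maps_I in auto)

lemma f_maps_E: "i < n \<Longrightarrow> f i ` E \<subseteq> E"
  using E_eq by blast

text \<open>Each end is the image of one of the two ends under its outer lap, so
  \<open>{c, d}\<close> is covered by its own images and is absorbed by \<open>E\<close>.\<close>

lemma ends_in_E: "c \<in> E" "d \<in> E"
proof -
  have lap1: "1 \<in> laps" "n + 1 \<in> laps" using hole_inside by auto
  have lt: "lap 1 < n" "lap (n + 1) < n" using lap_image(1) lap1 by blast+
  have "c \<in> f (lap 1) ` {c, d}"
    using lap_ends(1,3)[OF lap1(1)] rho_nz[OF lt(1)] a_ends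
    by (cases "0 < \<rho> (lap 1)") auto
  moreover have "d \<in> f (lap (n + 1)) ` {c, d}"
    using lap_ends(2,4)[OF lap1(2)] rho_nz[OF lt(2)] a_ends
    by (cases "0 < \<rho> (lap (n + 1))") auto
  ultimately have "{c, d} \<subseteq> (\<Union>i<n. f i ` {c, d})" using lt by blast
  from subset_of_invariant[OF _ this compact_imp_closed[OF E_compact] E_ne f_maps_E]
  have "{c, d} \<subseteq> E" by simp
  then show "c \<in> E" "d \<in> E" by auto
qed

section \<open>Lower bound for the dimension by mass distribution\<close>

primrec cyl :: "nat \<Rightarrow> real set set" where
  "cyl 0 = {{c..d}}"
| "cyl (Suc k) = (\<Union>i<n. (\<lambda>C. f i ` C) ` cyl k)"

lemma cyl_meets_E: "C \<in> cyl k \<Longrightarrow> C \<inter> E \<noteq> {}"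
proof (induction k arbitrary: C)
  case 0
  then show ?case using E_subset_I E_ne by auto
next
  case (Suc k)
  then obtain i B where i: "i < n" "B \<in> cyl k" "C = f i ` B" by auto
  then obtain x where "x \<in> B" "x \<in> E" using Suc.IH by blast
  then have "f i x \<in> C \<inter> E" using i E_eq by blast
  then show ?case by blast
qed

lemma cyl_small: "C \<in> cyl k \<Longrightarrow> x \<in> C \<Longrightarrow> y \<in> C \<Longrightarrow> dist x y \<le> rmax ^ k * (d - c)"
proof (induction k arbitrary: C x y)
  case 0
  then show ?case by (auto simp: dist_real_def)
next
  case (Suc k)
  then obtain i B where i: "i < n" "B \<in> cyl k" "C = f i ` B" by auto
  then obtain x' y' where "x' \<in> B" "y' \<in> B" "x = f i x'" "y = f i y'" using Suc.prems by auto
  moreover have "\<bar>\<rho> i\<bar> * dist x' y' \<le> rmax * (rmax ^ k * (d - c))"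
    using Suc.IH[OF i(2)] calculation rmax(1)[OF i(1)] rmax(2) by (intro mult_mono) auto
  ultimately show ?case by (simp add: dist_f mult.assoc)
qed

text \<open>The finite-level counterpart of subadditivity for a probability measure; the induction
  pulls the whole family back through each branch.\<close>

lemma cyl_mass:
  assumes "weight \<beta> = 1" "finite A"
  shows "(\<And>C. C \<in> cyl k \<Longrightarrow> \<exists>i\<in>A. C \<subseteq> U i) \<Longrightarrow> 1 \<le> (\<Sum>i\<in>A. mass \<beta> k (U i))"
proof (induction k arbitrary: U)
  case 0
  then obtain i where "i \<in> A" "{c..d} \<subseteq> U i" by auto
  then have "1 \<le> mass \<beta> 0 (U i)" by simp
  also have "\<dots> \<le> (\<Sum>i\<in>A. mass \<beta> 0 (U i))"
    using assms \<open>i \<in> A\<close> by (intro member_le_sum mass_nonneg) auto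
  finally show ?case .
next
  case (Suc k)
  have "1 = (\<Sum>j<n. \<bar>\<rho> j\<bar> powr \<beta> * 1)" using assms by (simp add: weight_def)
  also have "\<dots> \<le> (\<Sum>j<n. \<bar>\<rho> j\<bar> powr \<beta> * (\<Sum>i\<in>A. mass \<beta> k (f j -` U i)))"
  proof (intro sum_mono mult_left_mono Suc.IH)
    fix j C assume "j \<in> {..<n}" "C \<in> cyl k"
    then obtain i where "i \<in> A" "f j ` C \<subseteq> U i" using Suc.prems[of "f j ` C"] by auto
    then show "\<exists>i\<in>A. C \<subseteq> f j -` U i" by blast
  qed auto
  also have "\<dots> = (\<Sum>i\<in>A. mass \<beta> (Suc k) (U i))"
    by (simp add: sum_distrib_left) (rule sum.swap)
  finally show ?case .
qed

text \<open>The sets are enlarged slightly to open intervals, of which finitely many cover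
  \<open>E\<close>. Cylinders smaller than a Lebesgue number of this cover lie in single members, so
  the masses add up to at least 1, while each mass is bounded by a power of the length.\<close>

lemma cover_sum_lower_bound:
  assumes \<beta>: "0 < \<beta>" "weight \<beta> = 1"
    and U: "E \<subseteq> (\<Union>i. U i)" "\<And>i. bounded (U i)"
  shows "ennreal (1 / (2 * mass_const \<beta>)) \<le> (\<Sum>i. ennreal (diameter (U i) powr \<beta>))"
proof (rule ennreal_le_epsilon)
  fix \<epsilon> :: real assume "0 < \<epsilon>"
  define K where "K = 2 * mass_const \<beta>"
  have K: "0 < K" using mass_const_pos[OF \<beta>] by (simp add: K_def)
  define e where "e i = \<epsilon> * (1/2) ^ Suc i" for i :: nat
  have e: "0 < e i" for i using \<open>0 < \<epsilon>\<close> by (simp add: e_def)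
  define D where "D i = diameter (U i)" for i
  have D: "0 \<le> D i" for i using diameter_ge_0[OF U(2)] by (simp add: D_def)
  \<comment> \<open>The length whose \<open>\<beta>\<close>-th power exceeds that of the diameter by
    exactly \<open>e i\<close>; this also gives sets of diameter 0 an open enlargement.\<close>
  define L where "L i = (D i powr \<beta> + e i) powr (1 / \<beta>)" for i
  have L_powr: "L i powr \<beta> = D i powr \<beta> + e i" for i
    using \<beta> e[of i] by (simp add: L_def powr_powr add_nonneg_pos less_imp_le)
  have DL: "D i < L i" for i
  proof -
    have "\<not> L i powr \<beta> \<le> D i powr \<beta>" using e[of i] L_powr by simp
    then have "\<not> L i \<le> D i" using powr_mono2[of \<beta> "L i" "D i"] \<beta> by (auto simp: L_def)
    then show ?thesis by simp
  qed
  have "\<exists>x. U i \<subseteq> {x..x + D i}" for i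
    using subset_interval_diameter[OF U(2)] unfolding D_def by blast
  then obtain x where x: "\<And>i. U i \<subseteq> {x i..x i + D i}" by metis
  define s where "s i = (L i - D i) / 2" for i
  have s: "0 < s i" for i using DL[of i] by (simp add: s_def)
  define V where "V i = {x i - s i<..<x i + D i + s i}" for i
  have UV: "U i \<subseteq> V i" for i using x[of i] s[of i] by (force simp: V_def)
  have "E \<subseteq> (\<Union>i\<in>UNIV. V i)" using U(1) UV by blast
  then obtain A where A: "finite A" "E \<subseteq> (\<Union>i\<in>A. V i)"
    by (rule compactE_image[OF E_compact, rotated]) (auto simp: V_def)
  obtain r where r: "0 < r" "\<And>z. z \<in> E \<Longrightarrow> \<exists>G\<in>V ` A. ball z r \<subseteq> G"
    by (rule Heine_Borel_lemma[OF E_compact, of "V ` A"]) (use A in \<open>auto simp: V_def\<close>)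
  obtain k where k: "rmax ^ k * (d - c) < r"
    using order_tendstoD(2)[OF rmax_power_tendsto r(1), of "d - c"]
    by (auto simp: eventually_sequentially)
  have mV: "mass \<beta> k (V i) \<le> K * (D i powr \<beta> + e i)" for i
  proof -
    have "mass \<beta> k (V i) \<le> mass \<beta> k {x i - s i..x i + D i + s i}"
      by (intro mass_mono) (auto simp: V_def)
    also have "\<dots> \<le> K * (x i + D i + s i - (x i - s i)) powr \<beta>"
      unfolding K_def using D[of i] s[of i] by (intro mass_interval[OF \<beta>]) auto
    also have "x i + D i + s i - (x i - s i) = L i" by (simp add: s_def field_simps)
    finally show ?thesis by (simp add: L_powr)
  qed
  have "1 \<le> (\<Sum>i\<in>A. mass \<beta> k (V i))"
  proof (rule cyl_mass[OF \<beta>(2) A(1)])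
    fix C assume C: "C \<in> cyl k"
    then obtain z where z: "z \<in> C" "z \<in> E" using cyl_meets_E by blast
    then obtain i where i: "i \<in> A" "ball z r \<subseteq> V i" using r(2) by blast
    have "C \<subseteq> ball z r" using cyl_small[OF C z(1)] k by fastforce
    then show "\<exists>i\<in>A. C \<subseteq> V i" using i by blast
  qed
  also have "\<dots> \<le> (\<Sum>i\<in>A. K * (D i powr \<beta> + e i))" by (intro sum_mono mV)
  also have "\<dots> = K * ((\<Sum>i\<in>A. D i powr \<beta>) + (\<Sum>i\<in>A. e i))"
    by (simp only: sum_distrib_left[symmetric] sum.distrib)
  also have "(\<Sum>i\<in>A. e i) \<le> \<epsilon>"
  proof -
    have "e sums (\<epsilon> * 1)" unfolding e_def by (intro sums_mult power_half_series)
    then have "summable e" "suminf e = \<epsilon>" by (simp_all add: sums_iff)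
    then show ?thesis using sum_le_suminf[of e A] A(1) less_imp_le[OF e] by simp
  qed
  finally have "1 \<le> K * ((\<Sum>i\<in>A. D i powr \<beta>) + \<epsilon>)" using K by simp
  then have "1 / K \<le> (\<Sum>i\<in>A. D i powr \<beta>) + \<epsilon>" using K by (simp add: field_simps)
  then have "ennreal (1 / K) \<le> ennreal ((\<Sum>i\<in>A. D i powr \<beta>) + \<epsilon>)" by (rule ennreal_leI)
  also have "\<dots> = (\<Sum>i\<in>A. ennreal (D i powr \<beta>)) + ennreal \<epsilon>"
    using \<open>0 < \<epsilon>\<close> by (simp add: ennreal_plus sum_nonneg sum_ennreal)
  also have "\<dots> \<le> (\<Sum>i. ennreal (D i powr \<beta>)) + ennreal \<epsilon>"
    using A(1) by (intro add_right_mono sum_le_suminf) auto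
  finally show "ennreal (1 / (2 * mass_const \<beta>)) \<le> (\<Sum>i. ennreal (diameter (U i) powr \<beta>)) + ennreal \<epsilon>"
    by (simp add: D_def K_def)
qed

lemma hausdorff_measure_nonzero:
  assumes \<beta>: "0 < \<beta>" "weight \<beta> = 1" and s: "0 \<le> s" "s \<le> \<beta>"
  shows "hausdorff_measure s E \<noteq> 0"
proof -
  have "0 < ennreal (1 / (2 * mass_const \<beta>))" using mass_const_pos[OF \<beta>] by simp
  also have "\<dots> \<le> hausdorff_content s 1 E"
    unfolding hausdorff_content_def
  proof (rule INF_greatest)
    fix U :: "nat \<Rightarrow> real set"
    assume "U \<in> {U. E \<subseteq> (\<Union>i. U i) \<and> (\<forall>i. bounded (U i) \<and> diameter (U i) \<le> 1)}"
    then have U: "E \<subseteq> (\<Union>i. U i)" "\<And>i. bounded (U i)" "\<And>i. diameter (U i) \<le> 1" by auto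
    have "diameter (U i) powr \<beta> \<le> dpow s (U i)" for i
    proof -
      have "diameter (U i) powr \<beta> \<le> diameter (U i) powr s"
        using s diameter_ge_0[OF U(2)] U(3) by (intro powr_mono') auto
      moreover have "diameter (U i) powr \<beta> \<le> 1"
        using \<beta> diameter_ge_0[OF U(2)] U(3) by (intro powr_le1) auto
      ultimately show ?thesis by (auto simp: dpow_def)
    qed
    then have "(\<Sum>i. ennreal (diameter (U i) powr \<beta>)) \<le> (\<Sum>i. ennreal (dpow s (U i)))"
      by (intro suminf_le ennreal_leI) auto
    then show "ennreal (1 / (2 * mass_const \<beta>)) \<le> (\<Sum>i. ennreal (dpow s (U i)))"
      using cover_sum_lower_bound[OF \<beta> U(1,2)] by (rule order_trans[rotated])
  qed
  also have "\<dots> \<le> hausdorff_measure s E"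
    unfolding hausdorff_measure_def by (rule SUP_upper) auto
  finally show ?thesis by simp
qed

section \<open>Upper bound for the dimension by cylinder covers\<close>

primrec ccover :: "nat \<Rightarrow> nat \<Rightarrow> real set" where
  "ccover 0 i = (if i = 0 then {c..d} else {})"
| "ccover (Suc k) i = f (i mod n) ` ccover k (i div n)"

text \<open>The base-\<open>n\<close> digits of the index choose the branches, the lowest digit
  being the outermost one. This turns the cylinders into a sequence, as
  \<open>hausdorff_content\<close> demands, with empty sets beyond the \<open>n ^ k\<close>
  words.\<close>

lemma ccover_empty: "n ^ k \<le> i \<Longrightarrow> ccover k i = {}"
proof (induction k arbitrary: i)
  case (Suc k)
  then have "n ^ k \<le> i div n" using n_ge by (simp add: less_eq_div_iff_mult_less_eq mult.commute)
  then show ?case using Suc.IH by simp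
qed auto

lemma E_subset_ccover: "E \<subseteq> (\<Union>i. ccover k i)"
proof (induction k)
  case 0
  then show ?case using E_subset_I by auto
next
  case (Suc k)
  show ?case
  proof
    fix x assume "x \<in> E"
    then obtain j y where j: "j < n" "y \<in> E" "x = f j y" using E_eq by blast
    then obtain i where "y \<in> ccover k i" using Suc.IH by blast
    then have "x \<in> ccover (Suc k) (i * n + j)" using j n_ge by simp
    then show "x \<in> (\<Union>i. ccover (Suc k) i)" by blast
  qed
qed

lemma ccover_small: "x \<in> ccover k i \<Longrightarrow> y \<in> ccover k i \<Longrightarrow> dist x y \<le> rmax ^ k * (d - c)"
proof (induction k arbitrary: i x y)
  case 0
  then show ?case by (auto simp: dist_real_def split: if_splits)
next
  case (Suc k)
  have i: "i mod n < n" using n_ge by simp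
  obtain x' y' where "x' \<in> ccover k (i div n)" "y' \<in> ccover k (i div n)"
    "x = f (i mod n) x'" "y = f (i mod n) y'" using Suc.prems by auto
  moreover have "\<bar>\<rho> (i mod n)\<bar> * dist x' y' \<le> rmax * (rmax ^ k * (d - c))"
    using Suc.IH calculation rmax(1)[OF i] rmax(2) by (intro mult_mono) auto
  ultimately show ?case by (simp add: dist_f mult.assoc)
qed

lemma ccover_bounded: "bounded (ccover k i)"
proof (cases "ccover k i = {}")
  case False
  then obtain x where "x \<in> ccover k i" by blast
  then show ?thesis using ccover_small[of x k i] unfolding bounded_def by blast
qed simp

lemma ccover_diameter: "diameter (ccover k i) \<le> rmax ^ k * (d - c)"
proof (rule diameter_le)
  show "norm (x - y) \<le> rmax ^ k * (d - c)" if "x \<in> ccover k i" "y \<in> ccover k i" for x y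
    using ccover_small[OF that] by (simp add: dist_norm)
qed (use rmax I_nontriv in auto)

lemma dpow_image:
  assumes "bounded U" "0 < s"
  shows "dpow s (f i ` U) \<le> \<bar>\<rho> i\<bar> powr s * dpow s U"
proof (cases "U = {}")
  case False
  have "diameter (f i ` U) \<le> \<bar>\<rho> i\<bar> * diameter U"
  proof (rule diameter_le)
    fix x y assume "x \<in> f i ` U" "y \<in> f i ` U"
    then obtain x' y' where "x' \<in> U" "y' \<in> U" "x = f i x'" "y = f i y'" by auto
    moreover have "dist (f i x') (f i y') \<le> \<bar>\<rho> i\<bar> * diameter U"
      using diameter_bounded_bound[OF assms(1), of x' y'] calculation
      by (simp add: dist_f mult_left_mono)
    ultimately show "norm (x - y) \<le> \<bar>\<rho> i\<bar> * diameter U"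
      by (simp add: dist_norm)
  qed (use False in auto)
  moreover have "bounded (f i ` U)"
  proof -
    obtain B where B: "\<And>x. x \<in> U \<Longrightarrow> \<bar>x\<bar> \<le> B" using assms(1) by (auto simp: bounded_iff)
    have "\<bar>f i x\<bar> \<le> \<bar>\<rho> i\<bar> * B + \<bar>\<rho>' i\<bar>" if "x \<in> U" for x
    proof -
      have "\<bar>\<rho> i * x\<bar> \<le> \<bar>\<rho> i\<bar> * B" using B[OF that] by (simp add: abs_mult mult_left_mono)
      then show ?thesis unfolding aff_def by linarith
    qed
    then show ?thesis by (auto simp: bounded_iff)
  qed
  ultimately have "diameter (f i ` U) powr s \<le> (\<bar>\<rho> i\<bar> * diameter U) powr s"
    using assms diameter_ge_0 by (intro powr_mono2) auto
  then show ?thesis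
    using False assms diameter_ge_0[OF assms(1)] by (simp add: dpow_def powr_mult)
qed (simp add: dpow_def)

text \<open>Blocks of \<open>n\<close> consecutive indices share the same parent, so each level
  contributes one factor \<open>weight s\<close>.\<close>

lemma ccover_sum:
  assumes "0 < s"
  shows "(\<Sum>i<n ^ k. dpow s (ccover k i)) \<le> weight s ^ k * (d - c) powr s"
proof (induction k)
  case 0
  then show ?case using assms I_nontriv by (simp add: dpow_def)
next
  case (Suc k)
  have "(\<Sum>i<n ^ Suc k. dpow s (ccover (Suc k) i))
      = (\<Sum>m<n ^ k. \<Sum>i=m * n..<m * n + n. dpow s (ccover (Suc k) i))"
    by (simp only: sum.nat_group power_Suc2)
  also have "\<dots> \<le> (\<Sum>m<n ^ k. weight s * dpow s (ccover k m))"
  proof (rule sum_mono)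
    fix m
    have "(\<Sum>i=m * n..<m * n + n. dpow s (ccover (Suc k) i))
        = (\<Sum>j<n. dpow s (ccover (Suc k) (j + m * n)))"
      using sum.shift_bounds_nat_ivl[of "\<lambda>i. dpow s (ccover (Suc k) i)" 0 "m * n" n]
      by (simp add: atLeast0LessThan add.commute)
    also have "\<dots> \<le> (\<Sum>j<n. \<bar>\<rho> j\<bar> powr s * dpow s (ccover k m))"
      using dpow_image[OF ccover_bounded assms] by (intro sum_mono) simp
    finally show "(\<Sum>i=m * n..<m * n + n. dpow s (ccover (Suc k) i)) \<le> weight s * dpow s (ccover k m)"
      by (simp add: weight_def sum_distrib_right)
  qed
  also have "\<dots> = weight s * (\<Sum>m<n ^ k. dpow s (ccover k m))" by (simp add: sum_distrib_left)
  also have "\<dots> \<le> weight s * (weight s ^ k * (d - c) powr s)"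
    using Suc weight_pos[of s] by simp
  finally show ?case by (simp add: mult.assoc)
qed

lemma hausdorff_measure_zero:
  assumes "0 < s" "weight s < 1"
  shows "hausdorff_measure s E = 0"
proof -
  have "hausdorff_content s \<delta> E \<le> 0" if \<delta>: "0 < \<delta>" for \<delta>
  proof (rule LIMSEQ_le_const)
    have "(\<lambda>k. weight s ^ k * (d - c) powr s) \<longlonglongrightarrow> 0"
      using weight_pos[of s] assms by (intro tendsto_mult_left_zero LIMSEQ_power_zero) auto
    then show "(\<lambda>k. ennreal (weight s ^ k * (d - c) powr s)) \<longlonglongrightarrow> 0"
      using tendsto_ennrealI by fastforce
    obtain k0 where k0: "\<And>k. k0 \<le> k \<Longrightarrow> rmax ^ k * (d - c) < \<delta>"
      using order_tendstoD(2)[OF rmax_power_tendsto \<delta>, of "d - c"]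
      by (auto simp: eventually_sequentially)
    have "hausdorff_content s \<delta> E \<le> ennreal (weight s ^ k * (d - c) powr s)" if "k0 \<le> k" for k
    proof -
      have "hausdorff_content s \<delta> E \<le> (\<Sum>i. ennreal (dpow s (ccover k i)))"
        unfolding hausdorff_content_def
      proof (rule INF_lower)
        have "diameter (ccover k i) \<le> \<delta>" for i
          using ccover_diameter[of k i] k0[OF that] by simp
        then show "ccover k \<in> {U. E \<subseteq> (\<Union>i. U i) \<and> (\<forall>i. bounded (U i) \<and> diameter (U i) \<le> \<delta>)}"
          using E_subset_ccover ccover_bounded by blast
      qed
      also have "\<dots> = (\<Sum>i<n ^ k. ennreal (dpow s (ccover k i)))"
        by (intro suminf_finite) (auto simp: ccover_empty dpow_def)
      also have "\<dots> = ennreal (\<Sum>i<n ^ k. dpow s (ccover k i))"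
        by (simp add: sum_ennreal dpow_nonneg)
      also have "\<dots> \<le> ennreal (weight s ^ k * (d - c) powr s)"
        by (intro ennreal_leI ccover_sum assms)
      finally show ?thesis .
    qed
    then show "\<exists>N. \<forall>k\<ge>N. hausdorff_content s \<delta> E \<le> ennreal (weight s ^ k * (d - c) powr s)"
      by blast
  qed
  then show ?thesis
    unfolding hausdorff_measure_def by (intro antisym SUP_least) auto
qed

theorem hausdorff_dim_attractor:
  assumes "weight \<beta> = 1"
  shows "hausdorff_dim E = \<beta>"
proof -
  have \<beta>: "0 < \<beta>"
  proof (rule ccontr)
    assume "\<not> 0 < \<beta>"
    then have "weight 0 \<le> weight \<beta>"
      using weight_strict_antimono[of \<beta> 0] by (cases "\<beta> = 0") auto
    then show False using weight_zero n_ge assms by simp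
  qed
  \<comment> \<open>The critical exponent itself is excluded because the measure there is positive;
    the infimum is still \<open>\<beta>\<close>.\<close>
  have "{s. 0 \<le> s \<and> hausdorff_measure s E = 0} = {\<beta><..}"
  proof (intro equalityI subsetI)
    fix s assume "s \<in> {s. 0 \<le> s \<and> hausdorff_measure s E = 0}"
    then show "s \<in> {\<beta><..}" using hausdorff_measure_nonzero[OF \<beta> assms, of s] by force
  next
    fix s assume "s \<in> {\<beta><..}"
    then show "s \<in> {s. 0 \<le> s \<and> hausdorff_measure s E = 0}"
      using \<beta> weight_strict_antimono[of \<beta> s] assms hausdorff_measure_zero[of s] by simp
  qed
  then show ?thesis by (simp add: hausdorff_dim_def)
qed

end

section \<open>Escape rate and topological entropy\<close>

context holed_ifs
begin

section \<open>Survivors and escape rate\<close>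

lemma inj_f: "i < n \<Longrightarrow> f i x = f i y \<Longrightarrow> x = y"
  using rho_nz[of i] by (simp add: aff_def)

lemma lap_unique:
  assumes "i < n" "i' < n" "y \<in> {c<..<d}" "f i y \<in> f i' ` {c..d}"
  shows "i' = i"
proof -
  obtain j where j: "j \<in> laps" "i = lap j" using lap_cases[OF assms(1)] by metis
  obtain j' where j': "j' \<in> laps" "i' = lap j'" "f i' ` {c..d} = {a j'..a (Suc j')}"
    using lap_cases[OF assms(2)] by metis
  have "a j < f i y" "f i y < a (Suc j)" using f_in_lap[OF j(1) assms(3)] j by auto
  moreover have "a j' \<le> f i y" "f i y \<le> a (Suc j')" using assms(4) j'(3) by auto
  ultimately have "\<not> a (Suc j) \<le> a j'" "\<not> a (Suc j') \<le> a j" by auto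
  then have "j = j'"
    using a_le[of "Suc j" j'] a_le[of "Suc j'" j] j j' by (cases j j' rule: linorder_cases) auto
  then show ?thesis using j j' by simp
qed

abbreviation F :: "real \<Rightarrow> real option" where "F \<equiv> Fopt n \<rho> \<rho>' c d"

text \<open>The branch that \<open>Fopt\<close> selects; where two laps touch it is a fixed but
  unspecified one of the two.\<close>

definition idx :: "real \<Rightarrow> nat" where
  "idx x = (SOME i. i < n \<and> x \<in> f i ` {c..d})"

lemma Fopt_in_lap:
  assumes "i < n" "x \<in> f i ` {c..d}"
  obtains y where "F x = Some y" "y \<in> {c..d}" "idx x < n" "x = f (idx x) y"
proof -
  have "idx x < n \<and> x \<in> f (idx x) ` {c..d}"
    unfolding idx_def by (rule someI[of _ i]) (use assms in auto)
  then obtain y where y: "idx x < n" "y \<in> {c..d}" "x = f (idx x) y" by auto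
  have "F x = Some ((x - \<rho>' (idx x)) / \<rho> (idx x))"
    using assms unfolding Fopt_def Let_def idx_def by auto
  also have "x - \<rho>' (idx x) = \<rho> (idx x) * y"
    using y(3) unfolding aff_def by linarith
  also have "\<rho> (idx x) * y / \<rho> (idx x) = y" using rho_nz[OF y(1)] by simp
  finally show thesis using that y by blast
qed

lemma Fopt_f:
  assumes "i < n" "y \<in> {c<..<d}"
  shows "F (f i y) = Some y"
proof -
  have "f i y \<in> f i ` {c..d}" using assms by auto
  then obtain z where z: "F (f i y) = Some z" "z \<in> {c..d}" "idx (f i y) < n"
      "f i y = f (idx (f i y)) z"
    using Fopt_in_lap[OF assms(1)] by blast
  then have "idx (f i y) = i" using lap_unique[OF assms(1) z(3) assms(2)] by blast
  then show ?thesis using z inj_f[OF assms(1)] by metis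
qed

lemma Fiter_Suc_shift:
  "Fiter n \<rho> \<rho>' c d (Suc k) x = Option.bind (F x) (Fiter n \<rho> \<rho>' c d k)"
  by (induction k) (auto split: Option.bind_splits)

abbreviation surv :: "nat \<Rightarrow> real set" where "surv \<equiv> survivors n \<rho> \<rho>' c d {p<..<q}"

lemma survivors_Suc_iff:
  assumes "F x = Some y" "y \<in> {c..d}"
  shows "x \<in> surv (Suc k) \<longleftrightarrow> x \<in> {c..d} - {p<..<q} \<and> y \<in> surv k"
proof -
  have "Fiter n \<rho> \<rho>' c d (Suc j) x = Fiter n \<rho> \<rho>' c d j y" for j
    using assms by (subst Fiter_Suc_shift) simp
  then have "(\<forall>j<Suc k. \<exists>z. Fiter n \<rho> \<rho>' c d j x = Some z \<and> z \<notin> {p<..<q}) \<longleftrightarrow>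
      x \<notin> {p<..<q} \<and> (\<forall>j<k. \<exists>z. Fiter n \<rho> \<rho>' c d j y = Some z \<and> z \<notin> {p<..<q})"
    unfolding All_less_Suc2 by (simp del: Fiter.simps(2))
  then show ?thesis using assms(2) by (auto simp: survivors_def simp del: Fiter.simps)
qed

primrec level :: "nat \<Rightarrow> real set" where
  "level 0 = {c..d}"
| "level (Suc k) = (\<Union>i<n. f i ` level k)"

lemma compact_level: "compact (level k)"
  by (induction k)
    (auto intro!: compact_UN compact_continuous_image continuous_intros simp: aff_def[abs_def])

lemma level_subset: "level k \<subseteq> {c..d}"
proof (induction k)
  case (Suc k)
  then show ?case using f_maps_I by auto
qed simp

text \<open>\<open>level\<close> follows all branches, while \<open>F\<close> follows a single one
  where laps touch. The two can disagree only at images of \<open>c\<close> and \<open>d\<close>,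
  finitely many new points at each step.\<close>

lemma survivors_level: "surv k \<subseteq> level k \<and> finite (level k - surv k)"
proof (induction k)
  case 0
  have "surv 0 = level 0" by (auto simp: survivors_def)
  then show ?case by simp
next
  case (Suc k)
  have "surv (Suc k) \<subseteq> level (Suc k)"
  proof
    fix x assume x: "x \<in> surv (Suc k)"
    then have "x \<in> {c..d}" "x \<notin> {p<..<q}" by (auto simp: survivors_def)
    then obtain i where "i < n" "x \<in> f i ` {c..d}" using cover by blast
    then obtain y where y: "F x = Some y" "y \<in> {c..d}" "idx x < n" "x = f (idx x) y"
      by (rule Fopt_in_lap)
    then have "y \<in> surv k" using survivors_Suc_iff x by blast
    then have "f (idx x) y \<in> level (Suc k)" using y(3) Suc.IH by auto
    then show "x \<in> level (Suc k)" using y(4) by simp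
  qed
  moreover have "level (Suc k) - surv (Suc k) \<subseteq> (\<Union>i<n. f i ` (level k - surv k) \<union> f i ` {c, d})"
  proof
    fix x assume x: "x \<in> level (Suc k) - surv (Suc k)"
    then obtain i y where i: "i < n" "y \<in> level k" "x = f i y" by auto
    have yI: "y \<in> {c..d}" using level_subset i by blast
    show "x \<in> (\<Union>i<n. f i ` (level k - surv k) \<union> f i ` {c, d})"
    proof (cases "y \<in> {c<..<d}")
      case True
      have "x \<in> f i ` {c..d}" using i yI by blast
      then have "x \<in> {c..d} - {p<..<q}" using disj_hole f_maps_I i(1) by blast
      moreover have "F x = Some y" using Fopt_f[OF i(1) True] i(3) by simp
      ultimately have "y \<notin> surv k" using x survivors_Suc_iff yI by blast
      then show ?thesis using i by blast
    next
      case False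
      then have "y \<in> {c, d}" using yI by auto
      then show ?thesis using i by blast
    qed
  qed
  moreover have "finite (\<Union>i<n. f i ` (level k - surv k) \<union> f i ` {c, d})"
    using Suc.IH by auto
  ultimately show ?case by (meson finite_subset)
qed

lemma measure_level: "measure lebesgue (level k) = weight 1 ^ k * (d - c)"
proof (induction k)
  case 0
  then show ?case using I_nontriv by simp
next
  case (Suc k)
  have "measure lebesgue (\<Union> ((\<lambda>i. f i ` level k) ` {..<n})) = (\<Sum>i<n. measure lebesgue (f i ` level k))"
  proof (rule measure_negligible_finite_Union_image)
    show "f i ` level k \<in> lmeasurable" for i
      by (intro lmeasurable_compact compact_continuous_image compact_level)
        (auto intro!: continuous_intros simp: aff_def[abs_def])
    show "pairwise (\<lambda>i j. negligible (f i ` level k \<inter> f j ` level k)) {..<n}"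
    proof (rule pairwiseI)
      fix i j assume ij: "i \<in> {..<n}" "j \<in> {..<n}" "i \<noteq> j"
      have "f i ` level k \<inter> f j ` level k \<subseteq> f i ` {c, d}"
      proof
        fix x assume "x \<in> f i ` level k \<inter> f j ` level k"
        then obtain y where y: "y \<in> {c..d}" "x = f i y" "x \<in> f j ` {c..d}"
          using level_subset by blast
        then have "y \<notin> {c<..<d}" using lap_unique[of i j y] ij by auto
        then have "y \<in> {c, d}" using y(1) by auto
        then show "x \<in> f i ` {c, d}" using y(2) by blast
      qed
      then show "negligible (f i ` level k \<inter> f j ` level k)"
        by (intro negligible_finite) (auto intro: finite_subset)
    qed
  qed simp
  also have "\<dots> = (\<Sum>i<n. \<bar>\<rho> i\<bar> * measure lebesgue (level k))"
  proof (rule sum.cong)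
    fix i
    show "measure lebesgue (f i ` level k) = \<bar>\<rho> i\<bar> * measure lebesgue (level k)"
      using measure_lebesgue_affine[of "\<rho> i" "\<rho>' i" "level k"] by (simp add: aff_def[abs_def])
  qed simp
  also have "\<dots> = weight 1 * measure lebesgue (level k)"
    by (simp add: weight_def sum_distrib_right)
  finally show ?case using Suc by simp
qed

lemma measure_survivors: "measure lebesgue (surv k) = weight 1 ^ k * (d - c)"
proof -
  have "negligible (level k - surv k)" "surv k - level k = {}"
    using survivors_level[of k] by (auto intro: negligible_finite)
  then have "measure lebesgue (surv k) = measure lebesgue (level k)"
    by (intro measure_negligible_symdiff lmeasurable_compact compact_level) simp
  then show ?thesis by (simp add: measure_level)
qed

theorem escape_rate:
  "(\<lambda>k. - ln (measure lebesgue (surv k)) / real k) \<longlonglongrightarrow> - ln (weight 1)"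
proof (rule Lim_transform_eventually)
  show "(\<lambda>k. - ln (weight 1) - ln (d - c) / real k) \<longlonglongrightarrow> - ln (weight 1)"
  proof -
    have "(\<lambda>k. x - y / real k) \<longlonglongrightarrow> x" for x y :: real by real_asymp
    then show ?thesis .
  qed
  have "- ln (weight 1) - ln (d - c) / real k = - ln (measure lebesgue (surv k)) / real k"
    if "k > 0" for k
  proof -
    have "ln (measure lebesgue (surv k)) = real k * ln (weight 1) + ln (d - c)"
      unfolding measure_survivors using weight_pos[of 1] I_nontriv by (simp add: ln_mult ln_realpow)
    then show ?thesis using that by (simp add: field_simps)
  qed
  then show "\<forall>\<^sub>F k in sequentially. - ln (weight 1) - ln (d - c) / real k
      = - ln (measure lebesgue (surv k)) / real k"
    using eventually_gt_at_top[of 0] by (rule eventually_mono[rotated])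
qed

end

section \<open>Topological entropy on the attractor: upper bound\<close>

lemma ln_ereal_le: "0 < r \<Longrightarrow> x \<le> ereal r \<Longrightarrow> ln_ereal x \<le> ereal (ln r)"
  by (cases x) (auto simp: ln_ereal_def)

lemma ln_ereal_ge: "0 < r \<Longrightarrow> ereal r \<le> x \<Longrightarrow> ereal (ln r) \<le> ln_ereal x"
  by (cases x) (auto simp: ln_ereal_def)

context holed_ifs_attractor
begin

abbreviation T :: "real \<Rightarrow> real" where "T \<equiv> Ftot n \<rho> \<rho>' c d"

text \<open>If the chosen preimage is interior, its branch is the one given by the self-similarity
  of \<open>E\<close>. Otherwise it is \<open>c\<close> or \<open>d\<close>, which lie in
  \<open>E\<close> whichever branch was chosen.\<close>

lemma T_E:
  assumes "x \<in> E"
  shows "T x \<in> E" "idx x < n" "x = f (idx x) (T x)"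
proof -
  obtain i e where i: "i < n" "e \<in> E" "x = f i e" using assms E_eq by blast
  have xi: "x \<in> f i ` {c..d}" using i E_subset_I by blast
  then obtain y where y: "F x = Some y" "y \<in> {c..d}" "idx x < n" "x = f (idx x) y"
    using Fopt_in_lap[OF i(1)] by blast
  have T: "T x = y" using y by (simp add: Ftot_def)
  show "idx x < n" "x = f (idx x) (T x)" using y T by auto
  show "T x \<in> E"
  proof (cases "y \<in> {c<..<d}")
    case True
    then have "i = idx x" using lap_unique[OF y(3) i(1), of y] y(4) xi by simp
    then have "e = y" using i(3) y(4) inj_f[OF i(1), of e y] by simp
    then show ?thesis using T i by simp
  next
    case False
    then have "y \<in> {c, d}" using y(2) by auto
    then show ?thesis using T ends_in_E by auto
  qed
qed

text \<open>Split the set according to the first branch. On one part \<open>T\<close> is injective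
  and expanding, so separation at time 0 persists at time 1 and the image is separated over one step
  fewer. The base case is time 0 alone, counted by boxes of side \<open>\<epsilon>\<close>.\<close>

lemma separated_card:
  assumes "0 < \<epsilon>" "separated_set T E (Suc k) \<epsilon> S"
  shows "real (card S) \<le> (real (nat \<lfloor>(d - c) / \<epsilon>\<rfloor>) + 1) * real n ^ k"
  using assms(2)
proof (induction k arbitrary: S)
  case 0
  let ?g = "\<lambda>x. nat \<lfloor>(x - c) / \<epsilon>\<rfloor>"
  have S: "S \<subseteq> E" "finite S" "\<And>x y. x \<in> S \<Longrightarrow> y \<in> S \<Longrightarrow> x \<noteq> y \<Longrightarrow> dist x y > \<epsilon>"
    using 0 by (auto simp: separated_set_def)
  have "inj_on ?g S"
  proof (rule inj_onI, rule ccontr)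
    fix x y assume xy: "x \<in> S" "y \<in> S" "?g x = ?g y" "x \<noteq> y"
    have "0 \<le> (x - c) / \<epsilon>" "0 \<le> (y - c) / \<epsilon>" using xy S(1) E_subset_I assms(1) by auto
    then have "\<lfloor>(x - c) / \<epsilon>\<rfloor> = \<lfloor>(y - c) / \<epsilon>\<rfloor>" using xy(3) by (simp add: nat_eq_iff)
    then have "\<bar>(x - c) / \<epsilon> - (y - c) / \<epsilon>\<bar> < 1" by linarith
    also have "(x - c) / \<epsilon> - (y - c) / \<epsilon> = (x - y) / \<epsilon>" by (simp add: diff_divide_distrib)
    finally have "\<bar>x - y\<bar> < \<epsilon>" using assms(1) by (simp add: abs_divide)
    then show False using S(3)[OF xy(1,2,4)] by (simp add: dist_real_def)
  qed
  moreover have "?g ` S \<subseteq> {..nat \<lfloor>(d - c) / \<epsilon>\<rfloor>}"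
    using S(1) E_subset_I assms(1) by (auto intro!: nat_mono floor_mono divide_right_mono)
  ultimately have "card S \<le> card {..nat \<lfloor>(d - c) / \<epsilon>\<rfloor>}"
    by (intro card_inj_on_le[of ?g]) auto
  then show ?case by simp
next
  case (Suc k)
  let ?M = "(real (nat \<lfloor>(d - c) / \<epsilon>\<rfloor>) + 1) * real n ^ k"
  have S: "S \<subseteq> E" "finite S" using Suc.prems by (auto simp: separated_set_def)
  have part: "real (card {x \<in> S. idx x = i}) \<le> ?M" if i: "i < n" for i
  proof -
    let ?S = "{x \<in> S. idx x = i}"
    have inv: "x = f i (T x)" if "x \<in> ?S" for x using T_E(3)[of x] that S(1) by auto
    then have "inj_on T ?S" by (metis (no_types, lifting) inj_onI)
    then have "card ?S = card (T ` ?S)" by (simp add: card_image)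
    moreover have "separated_set T E (Suc k) \<epsilon> (T ` ?S)"
      unfolding separated_set_def
    proof (intro conjI ballI impI)
      show "T ` ?S \<subseteq> E" using T_E(1) S(1) by auto
      show "finite (T ` ?S)" using S(2) by simp
      fix u v assume "u \<in> T ` ?S" "v \<in> T ` ?S" "u \<noteq> v"
      then obtain x y where xy: "x \<in> ?S" "y \<in> ?S" "u = T x" "v = T y" "x \<noteq> y" by auto
      then obtain j where j: "j < Suc (Suc k)" "dist ((T ^^ j) x) ((T ^^ j) y) > \<epsilon>"
        using Suc.prems unfolding separated_set_def by blast
      show "\<exists>j<Suc k. dist ((T ^^ j) u) ((T ^^ j) v) > \<epsilon>"
      proof (cases j)
        case 0
        have "dist x y = \<bar>\<rho> i\<bar> * dist u v"
          using inv[OF xy(1)] inv[OF xy(2)] xy(3,4) dist_f by metis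
        also have "\<dots> \<le> 1 * dist u v" using contr i by (intro mult_right_mono) auto
        finally have "dist ((T ^^ 0) u) ((T ^^ 0) v) > \<epsilon>" using j 0 by simp
        then show ?thesis by blast
      next
        case (Suc j')
        then have "dist ((T ^^ j') u) ((T ^^ j') v) > \<epsilon>"
          using j(2) xy(3,4) by (simp add: funpow_swap1)
        then show ?thesis using j(1) Suc by auto
      qed
    qed
    ultimately show ?thesis using Suc.IH by simp
  qed
  have "(\<Union>i<n. {x \<in> S. idx x = i}) = S" using T_E(2) S(1) by auto
  then have "card S \<le> (\<Sum>i<n. card {x \<in> S. idx x = i})"
    using card_UN_le[of "{..<n}" "\<lambda>i. {x \<in> S. idx x = i}"] by simp
  then have "real (card S) \<le> (\<Sum>i<n. real (card {x \<in> S. idx x = i}))"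
    unfolding of_nat_sum[symmetric] by (rule of_nat_mono)
  also have "\<dots> \<le> (\<Sum>i<n. ?M)" using part by (intro sum_mono) auto
  finally show ?case by (simp add: algebra_simps)
qed

lemma entropy_upper: "topological_entropy T E \<le> ereal (ln n)"
  unfolding topological_entropy_def
proof (rule SUP_least)
  fix \<epsilon> :: real assume "\<epsilon> \<in> {0<..}"
  then have \<epsilon>: "0 < \<epsilon>" by simp
  define M where "M = real (nat \<lfloor>(d - c) / \<epsilon>\<rfloor>) + 1"
  have M: "0 < M" by (simp add: M_def)
  have n: "0 < real n" using n_ge by simp
  have le: "ln_ereal (max_separated T E k \<epsilon>) / ereal (real k)
      \<le> ereal ((ln M + (real k - 1) * ln n) / real k)" if "0 < k" for k
  proof -
    have "max_separated T E k \<epsilon> \<le> ereal (M * real n ^ (k - 1))"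
      unfolding max_separated_def M_def using separated_card[OF \<epsilon>, of "k - 1"] that
      by (intro Sup_least) auto
    then have "ln_ereal (max_separated T E k \<epsilon>) \<le> ereal (ln (M * real n ^ (k - 1)))"
      using M n by (intro ln_ereal_le) auto
    also have "ln (M * real n ^ (k - 1)) = ln M + (real k - 1) * ln n"
      using M n that by (simp add: ln_mult ln_realpow of_nat_diff)
    finally have "ln_ereal (max_separated T E k \<epsilon>) / ereal (real k)
        \<le> ereal (ln M + (real k - 1) * ln n) / ereal (real k)"
      using that by (intro ereal_divide_right_mono) auto
    then show ?thesis using that by simp
  qed
  have "limsup (\<lambda>k. ln_ereal (max_separated T E k \<epsilon>) / ereal (real k))
      \<le> limsup (\<lambda>k. ereal ((ln M + (real k - 1) * ln n) / real k))"
    using le by (intro Limsup_mono eventually_mono[OF eventually_gt_at_top[of 0]]) auto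
  also have "\<dots> = ereal (ln n)"
  proof (rule lim_imp_Limsup)
    have "(\<lambda>k. (ln M + (real k - 1) * ln n) / real k) \<longlonglongrightarrow> ln n"
      by real_asymp
    then show "(\<lambda>k. ereal ((ln M + (real k - 1) * ln n) / real k)) \<longlonglongrightarrow> ereal (ln n)"
      by simp
  qed simp
  finally show "limsup (\<lambda>k. ln_ereal (max_separated T E k \<epsilon>) / ereal (real k)) \<le> ereal (ln n)" .
qed

section \<open>Topological entropy on the attractor: lower bound\<close>

primrec fw :: "nat list \<Rightarrow> real \<Rightarrow> real" where
  "fw [] y = y"
| "fw (i # v) y = f i (fw v y)"

definition words :: "nat \<Rightarrow> nat list set" where
  "words m = {v. set v \<subseteq> {..<n} \<and> length v = m}"

lemma finite_words: "finite (words m)" and card_words: "card (words m) = n ^ m"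
  using finite_lists_length_eq[of "{..<n}" m] card_lists_length_eq[of "{..<n}" m]
  by (simp_all add: words_def)

lemma fw_Ioo: "set v \<subseteq> {..<n} \<Longrightarrow> y \<in> {c<..<d} \<Longrightarrow> fw v y \<in> {c<..<d}"
  using f_maps_Ioo by (induction v) auto

lemma fw_E: "set v \<subseteq> {..<n} \<Longrightarrow> y \<in> E \<Longrightarrow> fw v y \<in> E"
  using f_maps_E by (induction v) auto

lemma T_fw: "set v \<subseteq> {..<n} \<Longrightarrow> y \<in> {c<..<d} \<Longrightarrow> (T ^^ length v) (fw v y) = y"
proof (induction v)
  case (Cons i v)
  then have "F (f i (fw v y)) = Some (fw v y)" by (intro Fopt_f fw_Ioo) auto
  then show ?case using Cons by (simp add: funpow_swap1 Ftot_def del: funpow.simps(2))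
      (simp add: funpow_Suc_right Ftot_def del: funpow.simps(2))
qed simp

lemma fw_inj:
  "length v = length v' \<Longrightarrow> set v \<subseteq> {..<n} \<Longrightarrow> set v' \<subseteq> {..<n} \<Longrightarrow>
    z \<in> {c<..<d} \<Longrightarrow> z' \<in> {c<..<d} \<Longrightarrow> fw v z = fw v' z' \<Longrightarrow> v = v'"
proof (induction v v' rule: list_induct2)
  case (Cons i v i' v')
  have "fw v z \<in> {c<..<d}" "fw v' z' \<in> {c<..<d}"
    using Cons.prems by (auto intro!: fw_Ioo simp del: greaterThanLessThan_iff)
  then have "i' = i"
    using Cons.prems lap_unique[of i i' "fw v z"] by auto
  then show ?case using Cons inj_f[of i "fw v z" "fw v' z'"] by auto
qed simp

lemma continuous_fw: "continuous_on A (fw v)"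
  by (induction v) (auto intro!: continuous_intros simp: aff_def)

text \<open>The first lap stays away from \<open>d\<close>. Its second letter is chosen so that the
  inner image avoids the end mapped to \<open>c\<close>: the last lap if the first one is
  increasing, the first lap itself if it is decreasing.\<close>

lemma interior_word:
  obtains i1 i2 where "i1 < n" "i2 < n" "f i1 ` f i2 ` {c..d} \<subseteq> {c<..<d}"
proof -
  have lap1: "1 \<in> laps" "n + 1 \<in> laps" using hole_inside by auto
  have lt: "lap 1 < n" "lap (n + 1) < n" using lap_image(1) lap1 by blast+
  have a2: "a 2 < d" "c < a (n + 1)" using a_less[of 2 "n + 2"] a_less[of 1 "n + 1"] a_ends n_ge by auto
  have img: "f (lap 1) ` {c..d} = {c..a 2}" "f (lap (n + 1)) ` {c..d} = {a (n + 1)..d}"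
    using lap_image(2)[OF lap1(1)] lap_image(2)[OF lap1(2)] a_ends by (simp_all add: numeral_2_eq_2)
  have sub: "f (lap 1) ` X \<subseteq> {c<..<d}" if "X \<subseteq> {c..d}" "\<And>x. x \<in> X \<Longrightarrow> c < f (lap 1) x" for X
    using img(1) that a2(1) by (force simp: image_subset_iff)
  show thesis
  proof (cases "0 < \<rho> (lap 1)")
    case True
    have fc: "f (lap 1) c = c" using lap_ends(1)[OF lap1(1) True] a_ends by simp
    have "f (lap 1) ` f (lap (n + 1)) ` {c..d} \<subseteq> {c<..<d}"
      unfolding img(2)
    proof (rule sub)
      fix x assume "x \<in> {a (n + 1)..d}"
      then have "\<rho> (lap 1) * c < \<rho> (lap 1) * x" using a2 True by auto
      then show "c < f (lap 1) x" using fc by (simp add: aff_def)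
    qed (use a2 in auto)
    then show thesis using that lt by blast
  next
    case False
    then have neg: "\<rho> (lap 1) < 0" using rho_nz[OF lt(1)] by simp
    have fd: "f (lap 1) d = c" using lap_ends(3)[OF lap1(1) neg] a_ends by simp
    have "f (lap 1) ` f (lap 1) ` {c..d} \<subseteq> {c<..<d}"
      unfolding img(1)
    proof (rule sub)
      fix x assume "x \<in> {c..a 2}"
      then have "\<rho> (lap 1) * d < \<rho> (lap 1) * x" using a2 neg by auto
      then show "c < f (lap 1) x" using fd by (simp add: aff_def)
    qed (use a2 in auto)
    then show thesis using that lt by blast
  qed
qed

text \<open>Images of an interior compact set under different words of equal length are disjoint
  compact sets, hence at positive distance, and there are only finitely many pairs.\<close>

lemma words_separated:
  assumes K: "compact K" "K \<subseteq> {c<..<d}"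
  obtains \<epsilon> where "0 < \<epsilon>"
    "\<And>v w x y. v \<in> words m \<Longrightarrow> w \<in> words m \<Longrightarrow> v \<noteq> w \<Longrightarrow> x \<in> K \<Longrightarrow> y \<in> K \<Longrightarrow> \<epsilon> < dist (fw v x) (fw w y)"
proof -
  define P where "P = {(v, w). v \<in> words m \<and> w \<in> words m \<and> v \<noteq> w}"
  have "finite P"
    by (rule finite_subset[of _ "words m \<times> words m"]) (auto simp: P_def finite_words)
  have "\<exists>r>0. \<forall>x\<in>fw (fst z) ` K. \<forall>y\<in>fw (snd z) ` K. r \<le> dist x y" if "z \<in> P" for z
  proof (rule separate_compact_closed)
    show "compact (fw (fst z) ` K)" by (intro compact_continuous_image continuous_fw K)
    show "closed (fw (snd z) ` K)"
      by (intro compact_imp_closed compact_continuous_image continuous_fw K)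
    show "fw (fst z) ` K \<inter> fw (snd z) ` K = {}"
    proof (rule ccontr)
      assume "fw (fst z) ` K \<inter> fw (snd z) ` K \<noteq> {}"
      then obtain x y where "x \<in> K" "y \<in> K" "fw (fst z) x = fw (snd z) y" by blast
      moreover from this have "x \<in> {c<..<d}" "y \<in> {c<..<d}" using K(2) by blast+
      ultimately show False
        using fw_inj[of "fst z" "snd z" x y] that by (auto simp: P_def words_def)
    qed
  qed
  then obtain r where r: "\<And>z. z \<in> P \<Longrightarrow> 0 < r z"
      "\<And>z x y. z \<in> P \<Longrightarrow> x \<in> fw (fst z) ` K \<Longrightarrow> y \<in> fw (snd z) ` K \<Longrightarrow> r z \<le> dist x y"
    by metis
  \<comment> \<open>Inserting 1 keeps the minimum meaningful when there are no two distinct words;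
    halving it later makes the inequality strict.\<close>
  define \<delta> where "\<delta> = Min (insert 1 (r ` P))"
  have "0 < \<delta>" using r(1) \<open>finite P\<close> by (auto simp: \<delta>_def)
  show thesis
  proof (rule that[of "\<delta> / 2"])
    fix v w x y assume vw: "v \<in> words m" "w \<in> words m" "v \<noteq> w" "x \<in> K" "y \<in> K"
    then have "(v, w) \<in> P" by (simp add: P_def)
    then have "\<delta> \<le> r (v, w)" using \<open>finite P\<close> by (auto simp: \<delta>_def)
    also have "\<dots> \<le> dist (fw v x) (fw w y)" using r(2)[OF \<open>(v, w) \<in> P\<close>] vw by auto
    finally show "\<delta> / 2 < dist (fw v x) (fw w y)" using \<open>0 < \<delta>\<close> by simp
  qed (use \<open>0 < \<delta>\<close> in simp)
qed

text \<open>Adjacent laps touch, so distinct words of length \<open>m\<close> need not give uniformly separated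
  cylinders.  Each block of \<open>m\<close> free symbols is therefore followed by two fixed ones that push
  the point into a compact subset of the open interval; this costs only a factor
  \<open>m / (m + 2)\<close> in the growth rate.\<close>
lemma entropy_block_bound: "ereal (real m * ln n / (real m + 2)) \<le> topological_entropy T E"
proof -
  obtain i1 i2 where i: "i1 < n" "i2 < n" "f i1 ` f i2 ` {c..d} \<subseteq> {c<..<d}" by (rule interior_word)
  define K where "K = f i1 ` f i2 ` {c..d}"
  have K: "compact K" "K \<subseteq> {c<..<d}"
    unfolding K_def using i(3)
    by (auto intro!: compact_continuous_image continuous_intros simp: aff_def[abs_def])
  obtain \<epsilon> where \<epsilon>: "0 < \<epsilon>" and sep: "\<And>v w x y. v \<in> words m \<Longrightarrow> w \<in> words m \<Longrightarrow> v \<noteq> w \<Longrightarrow>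
      x \<in> K \<Longrightarrow> y \<in> K \<Longrightarrow> \<epsilon> < dist (fw v x) (fw w y)"
    using words_separated[OF K] by metis
  define X where "X = E \<inter> {c<..<d}"
  define L where "L = m + 2"
  define \<phi> where "\<phi> v y = fw (v @ [i1, i2]) y" for v y
  have fw_append: "fw (v @ v') y = fw v (fw v' y)" for v v' y by (induction v) auto
  have \<phi>: "\<phi> v y \<in> X" "(T ^^ L) (\<phi> v y) = y" "\<exists>x\<in>K. \<phi> v y = fw v x"
    if "v \<in> words m" "y \<in> X" for v y
  proof -
    have v: "set (v @ [i1, i2]) \<subseteq> {..<n}" "length (v @ [i1, i2]) = L"
      using that i by (auto simp: words_def L_def)
    show "\<phi> v y \<in> X" using fw_E[OF v(1)] fw_Ioo[OF v(1)] that by (simp add: \<phi>_def X_def)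
    show "(T ^^ L) (\<phi> v y) = y" using T_fw[OF v(1), of y] that unfolding v(2) by (simp add: \<phi>_def X_def)
    show "\<exists>x\<in>K. \<phi> v y = fw v x" using that by (auto simp: \<phi>_def fw_append K_def X_def)
  qed
  obtain z where z: "z \<in> X"
  proof -
    have "f i1 (f i2 c) \<in> E" using ends_in_E f_maps_E i by blast
    moreover have "f i1 (f i2 c) \<in> {c<..<d}" 
    proof -
      have "c \<in> {c..d}" using I_nontriv by simp
      then show ?thesis using i(3) by blast
    qed
    ultimately show thesis using that by (simp add: X_def)
  qed
  \<comment> \<open>Prepending a block to each old point multiplies the count by
    \<open>n ^ m\<close>. Different blocks are separated at time 0, and equal blocks inherit the
    separation of their tails \<open>L\<close> steps later.\<close>
  have large: "\<exists>S. S \<subseteq> X \<and> separated_set T E (N * L) \<epsilon> S \<and> card S = (n ^ m) ^ N" for N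
  proof (induction N)
    case 0
    have "{z} \<subseteq> X \<and> separated_set T E (0 * L) \<epsilon> {z} \<and> card {z} = (n ^ m) ^ 0"
      using z by (auto simp: separated_set_def X_def)
    then show ?case by blast
  next
    case (Suc N)
    then obtain S where S: "S \<subseteq> X" "separated_set T E (N * L) \<epsilon> S" "card S = (n ^ m) ^ N" by blast
    have finS: "finite S" using S(2) by (simp add: separated_set_def)
    define S' where "S' = (\<lambda>(v, y). \<phi> v y) ` (words m \<times> S)"
    have far: "\<epsilon> < dist (\<phi> v y) (\<phi> w y')"
      if "v \<in> words m" "w \<in> words m" "v \<noteq> w" "y \<in> S" "y' \<in> S" for v w y y'
      using \<phi>(3)[of v y] \<phi>(3)[of w y'] sep that S(1) by (metis subsetD)
    have "inj_on (\<lambda>(v, y). \<phi> v y) (words m \<times> S)"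
    proof (rule inj_onI, clarify)
      fix v y w y' assume *: "v \<in> words m" "y \<in> S" "w \<in> words m" "y' \<in> S" "\<phi> v y = \<phi> w y'"
      then have "v = w" using far[of v w y y'] \<epsilon> by auto
      moreover have "y = y'" using * \<phi>(2)[of v y] \<phi>(2)[of w y'] S(1) by (metis subsetD)
      ultimately show "v = w \<and> y = y'" by simp
    qed
    then have "card S' = (n ^ m) ^ Suc N"
      unfolding S'_def by (simp add: card_image card_cartesian_product card_words S(3))
    moreover have "S' \<subseteq> X" using \<phi>(1) S(1) by (auto simp: S'_def)
    moreover have "separated_set T E (Suc N * L) \<epsilon> S'"
      unfolding separated_set_def
    proof (intro conjI ballI impI)
      show "S' \<subseteq> E" using \<open>S' \<subseteq> X\<close> by (auto simp: X_def)
      show "finite S'" using finS finite_words by (simp add: S'_def)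
      fix x x' assume "x \<in> S'" "x' \<in> S'" "x \<noteq> x'"
      then obtain v y w y' where *: "v \<in> words m" "y \<in> S" "w \<in> words m" "y' \<in> S"
          "x = \<phi> v y" "x' = \<phi> w y'"
        by (auto simp: S'_def)
      show "\<exists>j<Suc N * L. \<epsilon> < dist ((T ^^ j) x) ((T ^^ j) x')"
      proof (cases "v = w")
        case False
        then have "\<epsilon> < dist ((T ^^ 0) x) ((T ^^ 0) x')" using far * by simp
        moreover have "0 < Suc N * L" by (simp add: L_def)
        ultimately show ?thesis by blast
      next
        case True
        then have "y \<noteq> y'" using * \<open>x \<noteq> x'\<close> by auto
        then obtain j where j: "j < N * L" "\<epsilon> < dist ((T ^^ j) y) ((T ^^ j) y')"
          using S(2) * unfolding separated_set_def by blast
        have "(T ^^ (j + L)) x = (T ^^ j) y" "(T ^^ (j + L)) x' = (T ^^ j) y'"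
          using \<phi>(2) * S(1) by (auto simp: funpow_add)
        then show ?thesis using j by (intro exI[of _ "j + L"]) auto
      qed
    qed
    ultimately show ?case by blast
  qed
  have n: "0 < real n" using n_ge by simp
  let ?X = "\<lambda>k. ln_ereal (max_separated T E k \<epsilon>) / ereal (real k)"
  have "ereal (real m * ln n / (real m + 2)) \<le> (?X \<circ> (\<lambda>N. N * L)) N" if "0 < N" for N
  proof -
    obtain S where S: "separated_set T E (N * L) \<epsilon> S" "card S = (n ^ m) ^ N" using large by blast
    have "ereal ((real n ^ m) ^ N) \<le> max_separated T E (N * L) \<epsilon>"
      unfolding max_separated_def using S by (intro Sup_upper) (auto intro!: exI[of _ S])
    then have le: "ereal (ln ((real n ^ m) ^ N)) \<le> ln_ereal (max_separated T E (N * L) \<epsilon>)"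
      using n by (intro ln_ereal_ge) auto
    define B where "B = real (N * L)"
    have B: "0 < B" using that by (simp add: B_def L_def add_pos_nonneg)
    have "ln ((real n ^ m) ^ N) = real N * (real m * ln n)" "B = real N * (real m + 2)"
      using n by (simp_all add: B_def ln_realpow L_def algebra_simps)
    then have "ln ((real n ^ m) ^ N) / B = real m * ln n / (real m + 2)"
      using that by (simp only: mult_divide_mult_cancel_left)
    then have "ereal (real m * ln n / (real m + 2)) = ereal (ln ((real n ^ m) ^ N)) / ereal B"
      using B by (simp only: ereal_divide) simp
    also have "\<dots> \<le> ln_ereal (max_separated T E (N * L) \<epsilon>) / ereal B"
      using le B by (intro ereal_divide_right_mono) auto
    finally show ?thesis by (simp add: B_def)
  qed
  \<comment> \<open>The estimate is available only at multiples of the block length, which suffices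
    because the entropy is defined by a limit superior.\<close>
  then have "ereal (real m * ln n / (real m + 2)) \<le> limsup (?X \<circ> (\<lambda>N. N * L))"
    by (intro le_Limsup eventually_mono[OF eventually_gt_at_top[of 0]]) auto
  also have "\<dots> \<le> limsup ?X"
    by (intro limsup_subseq_mono strict_monoI mult_less_mono1) (simp_all add: L_def)
  also have "\<dots> \<le> topological_entropy T E"
    unfolding topological_entropy_def using \<epsilon> by (intro SUP_upper) auto
  finally show ?thesis .
qed

theorem entropy_attractor: "topological_entropy T E = ereal (ln n)"
proof (rule antisym[OF entropy_upper])
  have "(\<lambda>m. real m * ln n / (real m + 2)) \<longlonglongrightarrow> ln n" by real_asymp
  then have "(\<lambda>m. ereal (real m * ln n / (real m + 2))) \<longlonglongrightarrow> ereal (ln n)" by simp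
  then show "ereal (ln n) \<le> topological_entropy T E"
    by (rule LIMSEQ_le_const2) (use entropy_block_bound in blast)
qed

end

theorem theorem3:
  fixes n :: nat and \<rho> \<rho>' :: "nat \<Rightarrow> real" and c d p q :: real
    and a :: "nat \<Rightarrow> real" and h :: nat and E :: "real set"
  assumes n_ge: "2 \<le> n"
    and I_nontriv: "c < d"
    and contr: "\<forall>i<n. 0 < \<bar>\<rho> i\<bar> \<and> \<bar>\<rho> i\<bar> < 1"
    and osc: "open_set_condition n (aff \<rho> \<rho>')"
    and E_attr: "compact E" "E \<noteq> {}" "E = (\<Union>i<n. aff \<rho> \<rho>' i ` E)"
    and hole_ne: "p < q"
    and cover: "{c..d} = {p<..<q} \<union> (\<Union>i<n. aff \<rho> \<rho>' i ` {c..d})"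
    and disj_laps: "\<forall>i<n. \<forall>j<n. i \<noteq> j \<longrightarrow>
                      interior (aff \<rho> \<rho>' i ` {c..d}) \<inter> interior (aff \<rho> \<rho>' j ` {c..d}) = {}"
    and disj_hole: "\<forall>i<n. {p<..<q} \<inter> aff \<rho> \<rho>' i ` {c..d} = {}"
    and a_mono: "\<forall>j\<in>{1..n+1}. a j < a (Suc j)"
    and a_ends: "a 1 = c" "a (n + 2) = d"
    and h_range: "1 \<le> h" "h \<le> n + 1"
    and hole_ends: "a h = p" "a (Suc h) = q"
    and laps_layout: "\<forall>j\<in>{1..n+1}. j \<noteq> h \<longrightarrow> (\<exists>i<n. aff \<rho> \<rho>' i ` {c..d} = {a j..a (Suc j)})"
    and orbits: "\<forall>e\<in>{2..n+1}. \<forall>s.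
        (\<exists>k l. 0 < l \<and> os_orbit n \<rho> \<rho>' a h (a e, s) k \<noteq> None \<and>
               map_option fst (os_orbit n \<rho> \<rho>' a h (a e, s) (k + l))
                 = map_option fst (os_orbit n \<rho> \<rho>' a h (a e, s) k))
      \<or> (\<exists>k y s'. os_orbit n \<rho> \<rho>' a h (a e, s) k = Some (y, s') \<and> lap_pos n a y s' = h)"
  shows
    "(\<forall>\<beta>. fps_value_at (kneading_det n \<rho> \<rho>' a h \<beta>) 1 0 \<and>
          (\<forall>\<beta>'. fps_value_at (kneading_det n \<rho> \<rho>' a h \<beta>') 1 0 \<longrightarrow> \<beta>' = \<beta>)
        \<longrightarrow> \<beta> = hausdorff_dim E)
   \<and> (\<forall>t1. 0 < t1 \<and> fps_value_at (kneading_det n \<rho> \<rho>' a h 1) t1 0 \<and>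
          (\<forall>t\<in>{0<..<t1}. \<not> fps_value_at (kneading_det n \<rho> \<rho>' a h 1) t 0)
        \<longrightarrow> (\<lambda>k. - ln (measure lebesgue (survivors n \<rho> \<rho>' c d {p<..<q} k)) / real k)
              \<longlonglongrightarrow> ln t1)
   \<and> (\<forall>t0. 0 < t0 \<and> fps_value_at (kneading_det n \<rho> \<rho>' a h 0) t0 0 \<and>
          (\<forall>t\<in>{0<..<t0}. \<not> fps_value_at (kneading_det n \<rho> \<rho>' a h 0) t 0)
        \<longrightarrow> topological_entropy (Ftot n \<rho> \<rho>' c d) E = ereal (ln (1 / t0)))"
proof -
  interpret holed_ifs_attractor n \<rho> \<rho>' c d p q a h E
    by unfold_locales (fact assms)+
  show ?thesis
  proof (intro conjI allI impI; elim conjE)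
    fix \<beta> assume "fps_value_at (kneading_det n \<rho> \<rho>' a h \<beta>) 1 0"
    then have "weight \<beta> = 1" using kneading_det_zero by fastforce
    then show "\<beta> = hausdorff_dim E" by (simp add: hausdorff_dim_attractor)
  next
    fix t1 assume "0 < t1" "fps_value_at (kneading_det n \<rho> \<rho>' a h 1) t1 0"
    then have "t1 = inverse (weight 1)"
      using kneading_det_zero[of 1 t1] by (simp add: inverse_unique mult.commute)
    then show "(\<lambda>k. - ln (measure lebesgue (survivors n \<rho> \<rho>' c d {p<..<q} k)) / real k)
        \<longlonglongrightarrow> ln t1"
      using escape_rate weight_pos[of 1] by (simp add: ln_inverse)
  next
    fix t0 assume "0 < t0" "fps_value_at (kneading_det n \<rho> \<rho>' a h 0) t0 0"
    then have "1 / t0 = real n"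
      using kneading_det_zero[of 0 t0] weight_zero by (simp add: field_simps)
    then show "topological_entropy (Ftot n \<rho> \<rho>' c d) E = ereal (ln (1 / t0))"
      using entropy_attractor by simp
  qed
qed

end
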